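(* Let $Q$ be a product separable group, let $Z$ be a finitely generated group, and let $G$ be a central extension of $Q$ by $Z$, i.e. there is a short exact sequence $1 \to Z \to G \to Q \to 1$ with the image of $Z$ contained in the centre of $G$. If $G$ is subgroup separable and $Q$ has bottlenecked product representatives over the class of its finitely generated subgroups, then $G$ is product separable.
   Context: The profinite topology on a group $G$ has as a basis of open sets the cosets of finite index subgroups of $G$. A subset of $G$ is separable if it is closed in the profinite topology on $G$. A group is subgroup separable if each of its finitely generated subgroups is separable. A group $G$ is product separable if for every natural number $n$ and all finitely generated subgroups $H_1,\dots,H_n \leqslant G$ the setwise product $H_1\cdots H_n$ is separable in $G$. Product representatives: let $G$ be a group and $H_1,\dots,H_n \leqslant G$ subgroups. Given $g \in H_1\cdots H_n$, a product representative of $g$ is a tuple $(h_1,\dots,h_n)\in H_1\times\cdots\times H_n$ with $g = h_1\cdots h_n$. For $i=1,\dots,n-1$ write $S_i = H_i\cap H_{i+1}$. Two product representatives $(h_1,\dots,h_n)$ and $(k_1,\dots,k_n)$ are equivalent if there are $s_1\in S_1,\dots,s_{n-1}\in S_{n-1}$ such that $s_{i-1}k_i = h_i s_i$ for each $i=1,\dots,n$, where $s_0=s_n=1$. (This is an equivalence relation.) Let $\mathcal C$ be a class of subgroups of $G$. The group $G$ has bottlenecked product representatives over $\mathcal C$ if for any $H_1,\dots,H_n\in\mathcal C$ and any $g\in H_1\cdots H_n$ there is a set $R\subseteq H_1\times\cdots\times H_n$ of product representatives of $g$ such that the projection of $R$ to $H_i$ has finite image for some $i\in\{1,\dots,n\}$,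 and every product representative of $g$ is equivalent to some product representative in $R$. *)

theory Defs
  imports "HOL-Algebra.Coset" "HOL-Algebra.Generated_Groups" "HOL-Analysis.Abstract_Topology"
begin

section \<open>The profinite topology and separability\<close>

text \<open>Right cosets suffice, since a left coset of a finite index subgroup is a right coset of a
  conjugate subgroup, which has the same index.\<close>

definition finite_index_coset :: "('a, 'b) monoid_scheme \<Rightarrow> 'a set \<Rightarrow> bool" where
  "finite_index_coset G U \<longleftrightarrow>
     (\<exists>N. subgroup N G \<and> finite (rcosets\<^bsub>G\<^esub> N) \<and> U \<in> rcosets\<^bsub>G\<^esub> N)"

definition profinite_topology :: "('a, 'b) monoid_scheme \<Rightarrow> 'a topology" where
  "profinite_topology G = topology (arbitrary union_of (finite_index_coset G))"

definition separable_in :: "('a, 'b) monoid_scheme \<Rightarrow> 'a set \<Rightarrow> bool" where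
  "separable_in G U \<longleftrightarrow> closedin (profinite_topology G) U"

definition finitely_generated_group :: "('a, 'b) monoid_scheme \<Rightarrow> bool" where
  "finitely_generated_group G \<longleftrightarrow>
     (\<exists>S. finite S \<and> S \<subseteq> carrier G \<and> carrier G = generate G S)"

definition fg_subgroups :: "('a, 'b) monoid_scheme \<Rightarrow> 'a set set" where
  "fg_subgroups G =
     {H. subgroup H G \<and> (\<exists>S. finite S \<and> S \<subseteq> carrier G \<and> H = generate G S)}"

definition subgroup_separable :: "('a, 'b) monoid_scheme \<Rightarrow> bool" where
  "subgroup_separable G \<longleftrightarrow> (\<forall>H\<in>fg_subgroups G. separable_in G H)"

text \<open>A family \<open>H\<^sub>1, \<dots>, H\<^sub>n\<close> with \<open>n \<ge> 1\<close> is a nonempty list of sets; entry \<open>i\<close> of the family is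
  entry \<open>i - 1\<close> of the list.\<close>

definition set_product :: "('a, 'b) monoid_scheme \<Rightarrow> 'a set list \<Rightarrow> 'a set" where
  "set_product G Hs = foldr (\<lambda>A B. A <#>\<^bsub>G\<^esub> B) Hs {\<one>\<^bsub>G\<^esub>}"

definition product_separable :: "('a, 'b) monoid_scheme \<Rightarrow> bool" where
  "product_separable G \<longleftrightarrow>
     (\<forall>Hs. Hs \<noteq> [] \<and> set Hs \<subseteq> fg_subgroups G \<longrightarrow> separable_in G (set_product G Hs))"

section \<open>Product representatives\<close>

definition product_reps :: "('a, 'b) monoid_scheme \<Rightarrow> 'a set list \<Rightarrow> 'a \<Rightarrow> 'a list set" where
  "product_reps G Hs g = {hs \<in> listset Hs. g = foldr (\<lambda>x y. x \<otimes>\<^bsub>G\<^esub> y) hs \<one>\<^bsub>G\<^esub>}"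

text \<open>Here \<open>s i\<close> is \<open>s\<^sub>i\<close> for \<open>0 \<le> i \<le> n\<close>, whereas \<open>Hs\<close>, \<open>hs\<close> and \<open>ks\<close> are indexed from 0: the
  condition \<open>s\<^sub>i \<in> S\<^sub>i = H\<^sub>i \<inter> H\<^sub>i\<^sub>+\<^sub>1\<close> concerns the list entries \<open>i - 1\<close> and \<open>i\<close>.\<close>

definition equiv_reps ::
    "('a, 'b) monoid_scheme \<Rightarrow> 'a set list \<Rightarrow> 'a list \<Rightarrow> 'a list \<Rightarrow> bool" where
  "equiv_reps G Hs hs ks \<longleftrightarrow>
     (\<exists>s :: nat \<Rightarrow> 'a.
        s 0 = \<one>\<^bsub>G\<^esub> \<and> s (length Hs) = \<one>\<^bsub>G\<^esub> \<and>
        (\<forall>i\<in>{1..<length Hs}. s i \<in> Hs ! (i - 1) \<inter> Hs ! i) \<and>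
        (\<forall>i<length Hs. s i \<otimes>\<^bsub>G\<^esub> ks ! i = hs ! i \<otimes>\<^bsub>G\<^esub> s (Suc i)))"

definition bottlenecked_product_reps :: "('a, 'b) monoid_scheme \<Rightarrow> 'a set set \<Rightarrow> bool" where
  "bottlenecked_product_reps G \<C> \<longleftrightarrow>
     (\<forall>Hs. Hs \<noteq> [] \<and> set Hs \<subseteq> \<C> \<longrightarrow>
       (\<forall>g\<in>set_product G Hs.
         \<exists>R\<subseteq>product_reps G Hs g.
           (\<exists>i<length Hs. finite ((\<lambda>hs. hs ! i) ` R)) \<and>
           (\<forall>hs\<in>product_reps G Hs g. \<exists>ks\<in>R. equiv_reps G Hs hs ks)))"

section \<open>Central extensions\<close>

definition group_centre :: "('a, 'b) monoid_scheme \<Rightarrow> 'a set" where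
  "group_centre G = {z \<in> carrier G. \<forall>g\<in>carrier G. z \<otimes>\<^bsub>G\<^esub> g = g \<otimes>\<^bsub>G\<^esub> z}"

text \<open>The library's \<open>short_exact_sequence\<close> requires all groups to have the same element type, so
  exactness of \<open>1 \<rightarrow> Z \<rightarrow> G \<rightarrow> Q \<rightarrow> 1\<close> is spelled out.\<close>

definition central_extension ::
    "('z, 'c) monoid_scheme \<Rightarrow> ('z \<Rightarrow> 'g) \<Rightarrow> ('g, 'd) monoid_scheme \<Rightarrow> ('g \<Rightarrow> 'q) \<Rightarrow>
     ('q, 'e) monoid_scheme \<Rightarrow> bool" where
  "central_extension Z \<iota> G \<pi> Q \<longleftrightarrow>
     group Z \<and> group G \<and> group Q \<and>
     \<iota> \<in> mon Z G \<and> \<pi> \<in> epi G Q \<and> \<iota> ` carrier Z = kernel G Q \<pi> \<and>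
     \<iota> ` carrier Z \<subseteq> group_centre G"

section \<open>Consistency of the encodings\<close>

text \<open>\<open>topology\<close> is only meaningful on families satisfying \<open>istopology\<close>.\<close>

lemma (in group) finite_index_coset_Int:
  assumes "finite_index_coset G U" "finite_index_coset G V" "x \<in> U \<inter> V"
  shows "finite_index_coset G (U \<inter> V)"
proof -
  from assms obtain M N where M: "subgroup M G" "finite (rcosets M)" "U \<in> rcosets M"
    and N: "subgroup N G" "finite (rcosets N)" "V \<in> rcosets N"
    unfolding finite_index_coset_def by blast
  have sub: "subgroup (M \<inter> N) G"
    using M(1) N(1) by (rule subgroups_Inter_pair)
  have Int: "(M \<inter> N) #> a = (M #> a) \<inter> (N #> a)" if "a \<in> carrier G" for a
    using that subgroup.subset[OF M(1)] subgroup.subset[OF N(1)]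
    by (auto simp: r_coset_def subset_iff)
  have "rcosets (M \<inter> N) \<subseteq> (\<lambda>(A, B). A \<inter> B) ` ((rcosets M) \<times> (rcosets N))"
    by (auto simp: RCOSETS_def Int image_iff)
  then have fin: "finite (rcosets (M \<inter> N))"
    using M(2) N(2) by (meson finite_SigmaI finite_imageI finite_subset)
  have x: "x \<in> carrier G"
    using assms(3) M(1,3) subgroup.rcosets_carrier[OF M(1) is_group] by blast
  have "U = M #> x" "V = N #> x"
    using M N assms(3) repr_independence x by (auto simp: RCOSETS_def)
  then have "U \<inter> V \<in> rcosets (M \<inter> N)"
    using Int[OF x] x by (auto simp: RCOSETS_def)
  then show ?thesis
    using sub fin unfolding finite_index_coset_def by blast
qed

lemma (in group) openin_profinite_topology:
  "openin (profinite_topology G) = arbitrary union_of (finite_index_coset G)"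
proof -
  have "istopology (arbitrary union_of (finite_index_coset G))"
    unfolding istopology_base_alt
  proof (intro allI impI, elim conjE)
    fix S T
    assume S: "(arbitrary union_of (finite_index_coset G)) S"
      and T: "(arbitrary union_of (finite_index_coset G)) T"
    show "(arbitrary union_of (finite_index_coset G)) (S \<inter> T)"
      unfolding arbitrary_union_of_alt
    proof
      fix x assume "x \<in> S \<inter> T"
      then obtain U V where "finite_index_coset G U" "x \<in> U" "U \<subseteq> S"
        "finite_index_coset G V" "x \<in> V" "V \<subseteq> T"
        using S T unfolding arbitrary_union_of_alt by blast
      then show "\<exists>W. finite_index_coset G W \<and> x \<in> W \<and> W \<subseteq> S \<inter> T"
        using finite_index_coset_Int[of U V x] by (intro exI[of _ "U \<inter> V"]) auto
    qed
  qed
  then show ?thesis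
    by (simp add: profinite_topology_def)
qed

lemma (in group) topspace_profinite_topology: "topspace (profinite_topology G) = carrier G"
proof
  show "topspace (profinite_topology G) \<subseteq> carrier G"
  proof
    fix x assume "x \<in> topspace (profinite_topology G)"
    then obtain U where "openin (profinite_topology G) U" "x \<in> U"
      unfolding topspace_def by blast
    then obtain N W where "subgroup N G" "W \<in> rcosets N" "x \<in> W"
      unfolding openin_profinite_topology arbitrary_union_of_alt finite_index_coset_def by blast
    then show "x \<in> carrier G"
      using subgroup.rcosets_carrier[OF _ is_group] by blast
  qed
  have "finite_index_coset G (carrier G)"
  proof -
    have "rcosets (carrier G) = {carrier G}"
      by (auto simp: RCOSETS_def coset_join2 subgroup_self)
    then show ?thesis
      unfolding finite_index_coset_def using subgroup_self by auto
  qed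
  then have "openin (profinite_topology G) (carrier G)"
    unfolding openin_profinite_topology by (rule arbitrary_union_of_inc)
  then show "carrier G \<subseteq> topspace (profinite_topology G)"
    by (rule openin_subset)
qed

lemma listset_iff: "hs \<in> listset Hs \<longleftrightarrow> length hs = length Hs \<and> (\<forall>i<length Hs. hs ! i \<in> Hs ! i)"
proof (induction Hs arbitrary: hs)
  case (Cons H Hs)
  then show ?case
    by (cases hs) (auto simp: set_Cons_def nth_Cons less_Suc_eq_0_disj split: nat.splits)
qed auto

lemma set_product_iff: "g \<in> set_product G Hs \<longleftrightarrow> product_reps G Hs g \<noteq> {}"
proof (induction Hs arbitrary: g)
  case Nil
  then show ?case by (auto simp: set_product_def product_reps_def)
next
  case (Cons H Hs)
  have "g \<in> set_product G (H # Hs) \<longleftrightarrow> (\<exists>h\<in>H. \<exists>k\<in>set_product G Hs. g = h \<otimes>\<^bsub>G\<^esub> k)"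
    by (auto simp: set_product_def set_mult_def)
  also have "\<dots> \<longleftrightarrow> product_reps G (H # Hs) g \<noteq> {}"
    unfolding Bex_def Cons.IH by (fastforce simp: product_reps_def set_Cons_def)
  finally show ?case .
qed

end

theory Submission
  imports Defs
begin

text \<open>
  Induct on the number of factors, for products \<open>P = K\<^sub>1\<cdots>K\<^sub>n A\<close> with \<open>A\<close> a subgroup of the central
  kernel. Let \<open>g\<close> lie outside \<open>P\<close>; if \<open>\<pi> g\<close> lies outside the image of \<open>P\<close>, it is separated in \<open>Q\<close>.
  Otherwise let \<open>B\<close> be the stabiliser of \<open>P\<close> in the kernel. It contains the central elements by which
  lifts of equivalent product representatives differ, so the bottleneck shows that \<open>P\<close> meets the fibre
  of \<open>\<pi> g\<close> in the same set as a finite union of products \<open>K\<^sub>1\<cdots>K\<^sub>i\<^sub>-\<^sub>1 r K\<^sub>i\<^sub>+\<^sub>1\<cdots>K\<^sub>n B \<subseteq> P\<close>, which is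
  separable by induction. Hence there is a normal subgroup \<open>N\<close> of finite index with
  \<open>g \<notin> P (N \<inter> ker \<pi>)\<close>. The latter product is separable: \<open>\<pi>\<close> is injective modulo \<open>N \<inter> ker \<pi>\<close> on each
  coset of \<open>N\<close>, and the part of the product inside such a coset is a finite union of translated
  products of finitely generated subgroups, whose image in \<open>Q\<close> is separable.
\<close>

section \<open>Finite index subgroups\<close>

text \<open>On \<open>A\<close> the map \<open>g\<close> factors through \<open>f\<close>. Finite
  index is proved this way below: cosets are determined by data with finitely many values.\<close>

lemma finite_image_factor:
  assumes "finite (f ` A)" and "\<And>x y. \<lbrakk>x \<in> A; y \<in> A; f x = f y\<rbrakk> \<Longrightarrow> g x = g y"
  shows "finite (g ` A)"
proof -
  have "g ` A \<subseteq> (\<lambda>z. g (inv_into A f z)) ` f ` A"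
  proof (intro image_subsetI)
    fix x assume "x \<in> A"
    then have "g x = g (inv_into A f (f x))"
      using assms(2) by (metis f_inv_into_f imageI inv_into_into)
    then show "g x \<in> (\<lambda>z. g (inv_into A f z)) ` f ` A"
      using \<open>x \<in> A\<close> by blast
  qed
  then show ?thesis
    using assms(1) finite_surj by blast
qed

context group
begin

lemma inv_mult_cancel:
  assumes "x \<in> carrier G" "y \<in> carrier G"
  shows "inv x \<otimes> (x \<otimes> y) = y" "x \<otimes> (inv x \<otimes> y) = y"
  using assms by (simp_all flip: m_assoc)

lemma rcosets_eq_image: "rcosets N = (\<lambda>x. N #> x) ` carrier G"
  by (auto simp: RCOSETS_def)

lemma r_coset_eq_iff:
  assumes "subgroup N G" "x \<in> carrier G" "y \<in> carrier G"
  shows "N #> x = N #> y \<longleftrightarrow> x \<otimes> inv y \<in> N"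
  by (metis assms rcos_self repr_independence subgroup.rcos_module[OF assms(1) is_group])

lemma mem_r_coset_iff:
  assumes "subgroup N G" "x \<in> carrier G"
  shows "y \<in> N #> x \<longleftrightarrow> y \<in> carrier G \<and> y \<otimes> inv x \<in> N"
proof -
  have "y \<in> carrier G" if "y \<in> N #> x"
    using that assms by (auto simp: r_coset_def dest: subgroup.mem_carrier)
  then show ?thesis
    using assms subgroup.rcos_module[OF assms(1) is_group] by blast
qed

text \<open>One representative is picked from each of the finitely many cosets of \<open>N\<close>
  that meet \<open>H\<close>. Taking them inside \<open>H\<close> puts the quotients
  \<open>h \<otimes> inv t\<close> in \<open>H \<inter> N\<close> when \<open>H\<close> is a
  subgroup.\<close>

lemma finite_transversal:
  assumes "subgroup N G" "finite (rcosets N)" "H \<subseteq> carrier G"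
  obtains T where "finite T" "T \<subseteq> H" "\<And>h. h \<in> H \<Longrightarrow> \<exists>t\<in>T. h \<otimes> inv t \<in> N"
proof -
  have "finite ((\<lambda>x. N #> x) ` H)"
    using assms(2,3) by (metis rcosets_eq_image finite_subset image_mono)
  then obtain T where T: "T \<subseteq> H" "finite T" "(\<lambda>x. N #> x) ` H = (\<lambda>x. N #> x) ` T"
    by (metis finite_subset_image order_refl)
  have "\<exists>t\<in>T. h \<otimes> inv t \<in> N" if "h \<in> H" for h
  proof -
    from that T(3) obtain t where "t \<in> T" "N #> h = N #> t"
      by (metis imageE imageI)
    then show ?thesis
      using r_coset_eq_iff[OF assms(1)] that T(1) assms(3) by (metis subsetD)
  qed
  with T that show ?thesis by blast
qed

text \<open>\<open>M\<close> is the intersection of the conjugates of \<open>N\<close>, which is the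
  kernel of the action of the group on the right cosets of \<open>N\<close>. That action has finite
  image.\<close>

lemma normal_core:
  assumes N: "subgroup N G" "finite (rcosets N)"
  obtains M where "M \<lhd> G" "finite (rcosets M)" "M \<subseteq> N"
proof -
  interpret N: subgroup N G by (rule N)
  define M where "M = {x \<in> carrier G. \<forall>c\<in>carrier G. c \<otimes> x \<otimes> inv c \<in> N}"
  have M_mult: "x \<otimes> y \<in> M" if "x \<in> M" "y \<in> M" for x y
  proof -
    have "c \<otimes> (x \<otimes> y) \<otimes> inv c = (c \<otimes> x \<otimes> inv c) \<otimes> (c \<otimes> y \<otimes> inv c)"
      if "c \<in> carrier G" for c
      using that \<open>x \<in> M\<close> \<open>y \<in> M\<close> by (simp add: M_def m_assoc inv_mult_cancel)
    then show ?thesis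
      using that by (simp add: M_def)
  qed
  have M_inv: "inv x \<in> M" if "x \<in> M" for x
  proof -
    have "c \<otimes> inv x \<otimes> inv c = inv (c \<otimes> x \<otimes> inv c)" if "c \<in> carrier G" for c
      using that \<open>x \<in> M\<close> by (simp add: M_def m_assoc inv_mult_group)
    then show ?thesis
      using that by (simp add: M_def)
  qed
  have sub: "subgroup M G"
    using M_mult M_inv by (intro subgroupI) (auto simp: M_def intro!: exI[of _ \<one>])
  have "x \<otimes> h \<otimes> inv x \<in> M" if "x \<in> carrier G" "h \<in> M" for x h
  proof -
    have "c \<otimes> (x \<otimes> h \<otimes> inv x) \<otimes> inv c = (c \<otimes> x) \<otimes> h \<otimes> inv (c \<otimes> x)" if "c \<in> carrier G" for c
      using that \<open>x \<in> carrier G\<close> \<open>h \<in> M\<close> by (simp add: M_def m_assoc inv_mult_group)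
    then show ?thesis
      using that by (simp add: M_def)
  qed
  then have "M \<lhd> G"
    using sub by (simp add: normal_inv_iff)
  moreover have "finite (rcosets M)"
    unfolding rcosets_eq_image[of M]
  proof (rule finite_image_factor)
    \<comment> \<open>This is the permutation of the cosets of \<open>N\<close> induced by
      \<open>x\<close>, restricted to \<open>rcosets N\<close> so that it lives in a finite function
      space.\<close>
    let ?f = "\<lambda>x. \<lambda>C\<in>rcosets N. C #> x"
    have "?f ` carrier G \<subseteq> rcosets N \<rightarrow>\<^sub>E rcosets N"
      by (force simp: RCOSETS_def coset_mult_assoc N.subset)
    then show "finite (?f ` carrier G)"
      using N(2) by (meson finite_PiE finite_subset)
    fix x y assume xy: "x \<in> carrier G" "y \<in> carrier G" "?f x = ?f y"
    have "c \<otimes> (x \<otimes> inv y) \<otimes> inv c \<in> N" if c: "c \<in> carrier G" for c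
    proof -
      have "N #> c #> x = N #> c #> y"
        using fun_cong[OF xy(3), of "N #> c"] c by (simp add: rcosetsI N.subset)
      then have "N #> (c \<otimes> x) = N #> (c \<otimes> y)"
        using c xy N.subset by (simp add: coset_mult_assoc)
      then show ?thesis
        using c xy N(1) by (simp add: r_coset_eq_iff inv_mult_group m_assoc)
    qed
    then have "x \<otimes> inv y \<in> M"
      using xy by (simp add: M_def)
    then show "M #> x = M #> y"
      using xy sub by (simp add: r_coset_eq_iff)
  qed
  moreover have "M \<subseteq> N"
    by (force simp: M_def dest: bspec[of _ _ \<one>])
  ultimately show ?thesis
    by (rule that)
qed

lemma finite_index_Int:
  assumes "M \<lhd> G" "finite (rcosets M)" "N \<lhd> G" "finite (rcosets N)"
  shows "M \<inter> N \<lhd> G" "finite (rcosets (M \<inter> N))"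
proof -
  show n: "M \<inter> N \<lhd> G"
    using assms(1,3) by (rule normal_subgroup_intersect)
  note sub = assms(1,3)[THEN normal_imp_subgroup] n[THEN normal_imp_subgroup]
  show "finite (rcosets (M \<inter> N))"
    unfolding rcosets_eq_image[of "M \<inter> N"]
  proof (rule finite_image_factor)
    let ?f = "\<lambda>x. (M #> x, N #> x)"
    have "?f ` carrier G \<subseteq> (rcosets M) \<times> (rcosets N)"
      by (auto simp: rcosets_eq_image)
    then show "finite (?f ` carrier G)"
      using assms by (meson finite_SigmaI finite_subset)
    show "(M \<inter> N) #> x = (M \<inter> N) #> y"
      if "x \<in> carrier G" "y \<in> carrier G" "?f x = ?f y" for x y
      using that by (auto simp: sub r_coset_eq_iff)
  qed
qed

end

section \<open>Separable sets\<close>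

context group
begin

text \<open>Passing to the normal core makes the cosets of normal subgroups of finite index a
  neighbourhood basis; normality is what later lets neighbourhoods be translated and
  conjugated.\<close>

lemma separable_in_iff:
  "separable_in G U \<longleftrightarrow> U \<subseteq> carrier G \<and>
     (\<forall>g\<in>carrier G - U. \<exists>N. N \<lhd> G \<and> finite (rcosets N) \<and> (N #> g) \<inter> U = {})"
    (is "_ \<longleftrightarrow> _ \<and> ?R")
proof -
  have "openin (profinite_topology G) (carrier G - U) \<longleftrightarrow> ?R"
    unfolding openin_profinite_topology arbitrary_union_of_alt
  proof (intro ball_cong refl iffI)
    fix g assume g: "g \<in> carrier G - U"
    assume "\<exists>V. finite_index_coset G V \<and> g \<in> V \<and> V \<subseteq> carrier G - U"
    then obtain V N where N: "subgroup N G" "finite (rcosets N)" "V \<in> rcosets N"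
      and V: "g \<in> V" "V \<subseteq> carrier G - U"
      unfolding finite_index_coset_def by blast
    obtain M where M: "M \<lhd> G" "finite (rcosets M)" "M \<subseteq> N"
      using normal_core N by blast
    have "V = N #> g"
      using N V g repr_independence by (auto simp: RCOSETS_def)
    then have "(M #> g) \<inter> U = {}"
      using V M(3) by (auto simp: r_coset_def)
    with M show "\<exists>N. N \<lhd> G \<and> finite (rcosets N) \<and> (N #> g) \<inter> U = {}"
      by blast
  next
    fix g assume g: "g \<in> carrier G - U"
    assume "\<exists>N. N \<lhd> G \<and> finite (rcosets N) \<and> (N #> g) \<inter> U = {}"
    then obtain N where N: "N \<lhd> G" "finite (rcosets N)" "(N #> g) \<inter> U = {}"
      by blast
    note s = normal_imp_subgroup[OF N(1)]
    have "finite_index_coset G (N #> g)"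
      unfolding finite_index_coset_def using s N g by (auto simp: rcosets_eq_image)
    moreover have "g \<in> N #> g"
      using s g by (simp add: rcos_self)
    moreover have "N #> g \<subseteq> carrier G - U"
      using s g N(3) by (auto simp: mem_r_coset_iff)
    ultimately show "\<exists>V. finite_index_coset G V \<and> g \<in> V \<and> V \<subseteq> carrier G - U"
      by blast
  qed
  then show ?thesis
    by (simp add: separable_in_def closedin_def topspace_profinite_topology)
qed

lemma separable_inE:
  assumes "separable_in G U" "g \<in> carrier G" "g \<notin> U"
  obtains N where "N \<lhd> G" "finite (rcosets N)" "(N #> g) \<inter> U = {}"
  using assms unfolding separable_in_iff by blast

lemma separable_in_Union:
  assumes "finite \<U>" "\<And>U. U \<in> \<U> \<Longrightarrow> separable_in G U"
  shows "separable_in G (\<Union>\<U>)"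
  using assms by (simp add: separable_in_def closedin_Union)

text \<open>Left translation is a homeomorphism: since \<open>N\<close> is normal, a neighbourhood
  \<open>N #> (inv x \<otimes> g)\<close> missing \<open>U\<close> is carried to
  \<open>N #> g\<close>, missing \<open>x <# U\<close>.\<close>

lemma separable_in_l_coset:
  assumes U: "separable_in G U" and x: "x \<in> carrier G"
  shows "separable_in G (x <# U)"
  unfolding separable_in_iff
proof (intro conjI ballI)
  have Uc: "U \<subseteq> carrier G"
    using U by (simp add: separable_in_iff)
  with x show "x <# U \<subseteq> carrier G"
    by (rule l_coset_subset_G[rotated])
  fix g assume g: "g \<in> carrier G - (x <# U)"
  have "inv x \<otimes> g \<notin> U"
    using g x inv_mult_cancel(2)[of x g] by (auto simp: l_coset_def)
  then obtain N where N: "N \<lhd> G" "finite (rcosets N)" "(N #> (inv x \<otimes> g)) \<inter> U = {}"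
    using separable_inE[OF U, of "inv x \<otimes> g"] g x by auto
  interpret N: normal N G by (rule N)
  have "(N #> g) \<inter> (x <# U) = {}"
  proof (rule ccontr)
    assume "\<not> ?thesis"
    then obtain n u where u: "n \<in> N" "u \<in> U" "n \<otimes> g = x \<otimes> u"
      by (auto simp: l_coset_def r_coset_def)
    have "(inv x \<otimes> n \<otimes> x) \<otimes> (inv x \<otimes> g) = inv x \<otimes> (n \<otimes> g)"
      using u x g by (simp add: m_assoc inv_mult_cancel)
    also have "\<dots> = u"
      using u x Uc by (auto simp: inv_mult_cancel)
    finally have "u \<in> N #> (inv x \<otimes> g)"
      using N.inv_op_closed1[OF x u(1)] by (auto simp: r_coset_def)
    with u N(3) show False by blast
  qed
  with N show "\<exists>N. N \<lhd> G \<and> finite (rcosets N) \<and> (N #> g) \<inter> (x <# U) = {}"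
    by blast
qed

end

section \<open>Separation through a homomorphism\<close>

lemma (in group_hom) normal_finite_index_vimage:
  assumes "N \<lhd> H" "finite (rcosets\<^bsub>H\<^esub> N)"
  shows "{x \<in> carrier G. h x \<in> N} \<lhd> G" (is "?M \<lhd> G")
    and "finite (rcosets\<^bsub>G\<^esub> {x \<in> carrier G. h x \<in> N})"
proof -
  interpret N: normal N H by (rule assms)
  have sub: "subgroup ?M G"
    by (intro G.subgroupI) auto
  then show "?M \<lhd> G"
    by (simp add: G.normal_inv_iff N.inv_op_closed2)
  show "finite (rcosets\<^bsub>G\<^esub> ?M)"
    unfolding G.rcosets_eq_image
  proof (rule finite_image_factor)
    have "(\<lambda>x. N #>\<^bsub>H\<^esub> h x) ` carrier G \<subseteq> rcosets\<^bsub>H\<^esub> N"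
      by (auto simp: H.rcosets_eq_image)
    then show "finite ((\<lambda>x. N #>\<^bsub>H\<^esub> h x) ` carrier G)"
      using assms(2) finite_subset by blast
    show "?M #> x = ?M #> y"
      if "x \<in> carrier G" "y \<in> carrier G" "N #>\<^bsub>H\<^esub> h x = N #>\<^bsub>H\<^esub> h y" for x y
      using that sub by (simp add: G.r_coset_eq_iff H.r_coset_eq_iff N.is_subgroup)
  qed
qed

text \<open>Homomorphisms are continuous for the profinite topologies: the preimage of a normal
  subgroup of finite index separating \<open>h g\<close> from \<open>C\<close> does the job.\<close>

lemma (in group_hom) separate_via_hom:
  assumes "separable_in H C" "g \<in> carrier G" "h g \<notin> C"
  obtains N where "N \<lhd> G" "finite (rcosets N)" "\<And>x. x \<in> N #> g \<Longrightarrow> h x \<notin> C"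
proof -
  obtain N where N: "N \<lhd> H" "finite (rcosets\<^bsub>H\<^esub> N)" "(N #>\<^bsub>H\<^esub> h g) \<inter> C = {}"
    using assms H.separable_inE hom_closed by metis
  show ?thesis
  proof (rule that[OF normal_finite_index_vimage[OF N(1,2)]])
    fix x assume "x \<in> {x \<in> carrier G. h x \<in> N} #> g"
    then have "h x \<in> N #>\<^bsub>H\<^esub> h g"
      using assms(2) by (auto simp: r_coset_def)
    with N(3) show "h x \<notin> C" by blast
  qed
qed

section \<open>Finitely generated subgroups\<close>

context group
begin

lemma fg_subgroups_iff: "H \<in> fg_subgroups G \<longleftrightarrow> (\<exists>S. finite S \<and> S \<subseteq> carrier G \<and> H = generate G S)"
  by (auto simp: fg_subgroups_def generate_is_subgroup)

text \<open>This is Schreier's lemma: a subgroup of finite index in a finitely generated group is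
  finitely generated. \<open>T\<close> need not be irredundant or contain the unit.\<close>

lemma fg_subgroup_finite_cover:
  assumes H: "H \<in> fg_subgroups G" and L: "subgroup L G" "L \<subseteq> H"
    and T: "finite T" "T \<subseteq> H" "\<And>x. x \<in> H \<Longrightarrow> \<exists>t\<in>T. x \<otimes> inv t \<in> L"
  shows "L \<in> fg_subgroups G"
proof -
  obtain S where S: "finite S" "S \<subseteq> carrier G" "H = generate G S"
    using H by (auto simp: fg_subgroups_iff)
  interpret H: subgroup H G
    using H by (simp add: fg_subgroups_def)
  interpret L: subgroup L G by (rule L)
  define U where "U = insert \<one> T"
  define S' where "S' = S \<union> m_inv G ` S"
  \<comment> \<open>The first part consists of the Schreier generators. The elements of
    \<open>U\<close> in \<open>L\<close> are added because the factorisation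
    \<open>x = y \<otimes> t\<close> of an element of \<open>L\<close> may end in such a
    \<open>t\<close>.\<close>
  define Y where "Y = (((\<lambda>(t, s, u). t \<otimes> s \<otimes> inv u) ` (U \<times> S' \<times> U)) \<union> U) \<inter> L"
  have UH: "U \<subseteq> H" and SH: "S' \<subseteq> H"
    using T(2) generate.incl[of _ S G] by (auto simp: U_def S'_def S(3)[symmetric])
  have fin: "finite Y"
    using T(1) S(1) by (simp add: Y_def U_def S'_def)
  have Yc: "Y \<subseteq> carrier G"
    by (auto simp: Y_def)
  have gY: "generate G Y \<subseteq> L"
    using L by (intro generate_subgroup_incl) (auto simp: Y_def)
  \<comment> \<open>This set contains the unit and is closed under right multiplication by the
    generators of \<open>H\<close> and their inverses, so it contains all of
    \<open>H\<close>.\<close>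
  define W where "W = {y \<otimes> t |y t. y \<in> generate G Y \<and> t \<in> U}"
  have step: "w \<otimes> s \<in> W" if w: "w \<in> W" and s: "s \<in> S'" for w s
  proof -
    obtain y t where y: "y \<in> generate G Y" and t: "t \<in> U" and w: "w = y \<otimes> t"
      using w by (auto simp: W_def)
    have c: "y \<in> carrier G" "t \<in> carrier G" "s \<in> carrier G" "t \<otimes> s \<in> H"
      using y t s UH SH gY by auto
    obtain u where u: "u \<in> T" "t \<otimes> s \<otimes> inv u \<in> L"
      using T(3) c(4) by blast
    then have "t \<otimes> s \<otimes> inv u \<in> Y"
      using t s by (force simp: Y_def U_def)
    then have "y \<otimes> (t \<otimes> s \<otimes> inv u) \<in> generate G Y"
      using y by (blast intro: generate.intros)
    moreover have "w \<otimes> s = y \<otimes> (t \<otimes> s \<otimes> inv u) \<otimes> u"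
      using c u(1) T(2) by (auto simp: w m_assoc)
    ultimately show ?thesis
      using u(1) by (auto simp: W_def U_def)
  qed
  have Wc: "W \<subseteq> carrier G"
    using subsetD[OF gY] subsetD[OF UH] by (auto simp: W_def)
  have "\<forall>w\<in>W. w \<otimes> x \<in> W" if "x \<in> generate G S" for x
    using that
  proof induction
    case one
    then show ?case using Wc by (auto simp: subset_iff)
  next
    case (eng h1 h2)
    then show ?case
      using Wc S(2) by (metis generate_in_carrier m_assoc subsetD)
  qed (auto simp: S'_def intro!: step)
  moreover have "\<one> \<in> W"
    by (force simp: W_def U_def intro: generate.one)
  ultimately have HW: "H \<subseteq> W"
    using H.subset by (fastforce simp: S(3))
  have "L \<subseteq> generate G Y"
  proof
    fix x assume x: "x \<in> L"
    then obtain y t where y: "y \<in> generate G Y" "t \<in> U" "x = y \<otimes> t"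
      using HW L(2) by (force simp: W_def)
    have "t = inv y \<otimes> x"
      using y(3) subsetD[OF gY y(1)] subsetD[OF UH y(2)] by (simp add: inv_mult_cancel)
    then have "t \<in> L"
      using x y(1) gY by auto
    then have "t \<in> Y"
      using y by (simp add: Y_def)
    then show "x \<in> generate G Y"
      using y by (auto intro: generate.intros)
  qed
  with gY fin Yc show ?thesis
    by (auto simp: fg_subgroups_iff)
qed

text \<open>A transversal of \<open>N\<close> chosen inside \<open>H\<close> supplies the finite
  cover needed for Schreier's lemma.\<close>

lemma fg_subgroup_Int_finite_index:
  assumes H: "H \<in> fg_subgroups G" and N: "subgroup N G" "finite (rcosets N)"
  shows "H \<inter> N \<in> fg_subgroups G"
proof -
  interpret H: subgroup H G
    using H by (simp add: fg_subgroups_def)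
  obtain T where T: "finite T" "T \<subseteq> H" "\<And>h. h \<in> H \<Longrightarrow> \<exists>t\<in>T. h \<otimes> inv t \<in> N"
    using finite_transversal[OF N H.subset] by blast
  show ?thesis
  proof (rule fg_subgroup_finite_cover[OF H _ _ T(1,2)])
    show "subgroup (H \<inter> N) G"
      by (rule subgroups_Inter_pair[OF H.is_subgroup N(1)])
    show "\<exists>t\<in>T. x \<otimes> inv t \<in> H \<inter> N" if "x \<in> H" for x
      using T(3)[OF that] T(2) that by auto
  qed simp
qed

section \<open>The centre and subgroups of finitely generated central subgroups\<close>

lemma centre_commute: "z \<in> group_centre G \<Longrightarrow> g \<in> carrier G \<Longrightarrow> z \<otimes> g = g \<otimes> z"
  by (simp add: group_centre_def)

lemma centre_closed: "z \<in> group_centre G \<Longrightarrow> z \<in> carrier G"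
  by (simp add: group_centre_def)

lemma subgroup_group_centre: "subgroup (group_centre G) G"
proof (rule subgroupI)
  fix a assume a: "a \<in> group_centre G"
  show "inv a \<in> group_centre G"
    unfolding group_centre_def
  proof (intro CollectI conjI ballI)
    fix g assume g: "g \<in> carrier G"
    have ac: "a \<in> carrier G" "a \<otimes> inv g = inv g \<otimes> a"
      using a g centre_commute[OF a] by (simp_all add: group_centre_def)
    have "inv a \<otimes> g = inv (inv g \<otimes> a)"
      using ac(1) g by (simp add: inv_mult_group)
    also have "\<dots> = inv (a \<otimes> inv g)"
      by (simp add: ac(2))
    also have "\<dots> = g \<otimes> inv a"
      using ac(1) g by (simp add: inv_mult_group)
    finally show "inv a \<otimes> g = g \<otimes> inv a" .
  qed (use a in \<open>simp add: group_centre_def\<close>)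
next
  fix a b assume ab: "a \<in> group_centre G" "b \<in> group_centre G"
  then have c: "a \<in> carrier G" "b \<in> carrier G"
    by (simp_all add: group_centre_def)
  have "a \<otimes> b \<otimes> g = g \<otimes> (a \<otimes> b)" if "g \<in> carrier G" for g
  proof -
    have "a \<otimes> b \<otimes> g = a \<otimes> (g \<otimes> b)"
      using that c by (simp add: m_assoc centre_commute[OF ab(2)])
    also have "\<dots> = g \<otimes> (a \<otimes> b)"
      using that c centre_commute[OF ab(1) that] by (simp flip: m_assoc)
    finally show ?thesis .
  qed
  then show "a \<otimes> b \<in> group_centre G"
    using c by (simp add: group_centre_def)
next
  have "\<one> \<in> group_centre G"
    by (simp add: group_centre_def)
  then show "group_centre G \<noteq> {}"
    by blast
qed (auto simp: group_centre_def)

text \<open>Since \<open>a\<close> is central, its powers can be collected on the left of any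
  word.\<close>

lemma generate_insert_central:
  assumes a: "a \<in> group_centre G" and S: "S \<subseteq> carrier G" and x: "x \<in> generate G (insert a S)"
  obtains k :: int and s where "s \<in> generate G S" "x = a [^] k \<otimes> s"
proof -
  have ac: "a \<in> carrier G"
    using a by (rule centre_closed)
  have ak: "a [^] k \<in> group_centre G" for k :: int
    using subgroup_group_centre a by (simp add: subgroup_int_pow_closed)
  have "\<exists>(k::int) s. s \<in> generate G S \<and> x = a [^] k \<otimes> s"
    using x
  proof induction
    case one
    show ?case by (intro exI[of _ 0] exI[of _ \<one>]) (simp add: generate.one)
  next
    case (incl h)
    show ?case
    proof (cases "h = a")
      case True
      then show ?thesis
        using ac by (intro exI[of _ 1] exI[of _ \<one>]) (simp add: generate.one)
    next
      case False
      then show ?thesis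
        using incl S by (intro exI[of _ 0] exI[of _ h]) (auto simp: generate.incl)
    qed
  next
    case (inv h)
    show ?case
    proof (cases "h = a")
      case True
      then show ?thesis
        using ac by (intro exI[of _ "-1"] exI[of _ \<one>]) (simp add: generate.one int_pow_neg)
    next
      case False
      then show ?thesis
        using inv S by (intro exI[of _ 0] exI[of _ "inv h"]) (auto simp: generate.inv)
    qed
  next
    case (eng h1 h2)
    then obtain k l :: int and s t where *: "s \<in> generate G S" "h1 = a [^] k \<otimes> s"
      "t \<in> generate G S" "h2 = a [^] l \<otimes> t"
      by blast
    have c: "s \<in> carrier G" "t \<in> carrier G"
      using * S generate_in_carrier by auto
    have "h1 \<otimes> h2 = a [^] k \<otimes> (s \<otimes> a [^] l) \<otimes> t"
      using c ac by (simp add: *(2,4) m_assoc)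
    also have "\<dots> = a [^] k \<otimes> (a [^] l \<otimes> s) \<otimes> t"
      by (simp only: centre_commute[OF ak c(1)])
    also have "\<dots> = a [^] (k + l) \<otimes> (s \<otimes> t)"
      using c ac by (simp add: int_pow_mult m_assoc)
    finally show ?case
      using * by (blast intro: generate.eng)
  qed
  then show ?thesis
    using that by blast
qed

text \<open>Subgroups of finitely generated abelian groups are finitely generated. Removing one
  generator \<open>a\<close>, the exponents of \<open>a\<close> occurring in \<open>B\<close> form a
  subgroup of the integers; an element \<open>b\<close> realising a generator of it, together with
  generators of \<open>B \<inter> generate G S\<close>, generates \<open>B\<close>.\<close>

lemma fg_subgroup_of_central:
  assumes "finite S" "S \<subseteq> group_centre G" "subgroup B G" "B \<subseteq> generate G S"
  shows "B \<in> fg_subgroups G"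
  using assms
proof (induction S arbitrary: B rule: finite_induct)
  case empty
  then show ?case
    using subgroup.one_closed[OF empty(2)]
    by (auto simp: fg_subgroups_iff generate_empty intro!: exI[of _ "{}"])
next
  case (insert a S)
  interpret B: subgroup B G by (rule insert.prems)
  have a: "a \<in> group_centre G" "a \<in> carrier G" and S: "S \<subseteq> carrier G"
    using insert.prems centre_closed by auto
  define B' where "B' = B \<inter> generate G S"
  have "B' \<in> fg_subgroups G"
    using insert.prems S
    by (intro insert.IH) (auto simp: B'_def intro!: subgroups_Inter_pair generate_is_subgroup)
  then obtain T where T: "finite T" "T \<subseteq> carrier G" "B' = generate G T"
    by (auto simp: fg_subgroups_iff)
  have TB: "T \<subseteq> B"
    using T(3) generate.incl[of _ T G] by (auto simp: B'_def)
  interpret S: subgroup "generate G S" G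
    using S by (rule generate_is_subgroup)
  define I where "I = {k::int. \<exists>s\<in>generate G S. a [^] k \<otimes> s \<in> B}"
  have ak: "a [^] k \<in> group_centre G" for k :: int
    using subgroup_group_centre a by (simp add: subgroup_int_pow_closed)
  have I_diff: "k - l \<in> I" if "k \<in> I" "l \<in> I" for k l
  proof -
    obtain s t where st: "s \<in> generate G S" "t \<in> generate G S" "a [^] k \<otimes> s \<in> B" "a [^] l \<otimes> t \<in> B"
      using \<open>k \<in> I\<close> \<open>l \<in> I\<close> unfolding I_def by blast
    have inv: "inv (a [^] l \<otimes> t) = inv t \<otimes> a [^] (- l)"
      using st a by (simp add: inv_mult_group int_pow_neg)
    have "(a [^] k \<otimes> s) \<otimes> inv (a [^] l \<otimes> t) = a [^] k \<otimes> ((s \<otimes> inv t) \<otimes> a [^] (- l))"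
      using st a by (simp add: inv m_assoc)
    also have "\<dots> = a [^] k \<otimes> (a [^] (- l) \<otimes> (s \<otimes> inv t))"
      using st a by (subst centre_commute[OF ak]) auto
    also have "\<dots> = a [^] (k - l) \<otimes> (s \<otimes> inv t)"
      using st a int_pow_mult[of a k "- l"] by (simp flip: m_assoc)
    finally have "a [^] (k - l) \<otimes> (s \<otimes> inv t) \<in> B"
      using st by (metis B.m_closed B.m_inv_closed)
    then show ?thesis
      using st(1,2) unfolding I_def by blast
  qed
  \<comment> \<open>A subgroup of the integers is cyclic: \<open>d\<close> is 0 or the least
    positive element.\<close>
  obtain d where d: "d \<in> I" "\<And>k. k \<in> I \<Longrightarrow> d dvd k"
  proof -
    have 0: "0 \<in> I"
      using B.one_closed by (auto simp: I_def intro!: bexI[of _ \<one>])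
    have minus: "- k \<in> I" if "k \<in> I" for k
      using I_diff[OF 0 that] by simp
    show thesis
    proof (cases "I = {0}")
      case True
      then show thesis by (intro that[of 0]) auto
    next
      case False
      define P where "P n \<longleftrightarrow> n > 0 \<and> int n \<in> I" for n
      obtain k where k: "k \<in> I" "k \<noteq> 0"
        using False 0 by blast
      then have "P (nat \<bar>k\<bar>)"
        using minus by (auto simp: P_def abs_if)
      then have m: "P (LEAST n. P n)"
        by (rule LeastI)
      define m where "m = (LEAST n. P n)"
      have mI: "int m \<in> I" "m > 0"
        using m by (auto simp: m_def P_def)
      have mult: "int m * int j \<in> I" for j
      proof (induction j)
        case (Suc j)
        have "int m * int j - (- int m) \<in> I"
          by (rule I_diff[OF Suc minus[OF mI(1)]])
        then show ?case by (simp add: algebra_simps)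
      qed (simp add: 0)
      have mult': "int m * j \<in> I" for j
      proof (cases j rule: int_cases2)
        case (nonneg n)
        then show ?thesis using mult by simp
      next
        case (nonpos n)
        then show ?thesis using minus[OF mult[of n]] by simp
      qed
      show thesis
      proof (rule that[OF mI(1)])
        fix k assume "k \<in> I"
        \<comment> \<open>The remainder stays in \<open>I\<close> and is smaller than
          \<open>m\<close>, so minimality forces it to vanish.\<close>
        then have "k mod int m \<in> I"
          using I_diff[OF \<open>k \<in> I\<close> mult'[of "k div int m"]] by (simp only: minus_mult_div_eq_mod)
        moreover have "nat (k mod int m) < m"
          using mI(2) by (simp add: nat_less_iff)
        then have "\<not> P (nat (k mod int m))"
          unfolding m_def by (rule not_less_Least)
        ultimately have "\<not> 0 < nat (k mod int m)"
          using mI(2) by (simp add: P_def)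
        moreover have "k mod int m \<ge> 0"
          using mI(2) by simp
        ultimately have "k mod int m = 0"
          by linarith
        then show "int m dvd k"
          by (rule mod_0_imp_dvd)
      qed
    qed
  qed
  obtain s0 where s0: "s0 \<in> generate G S" "a [^] d \<otimes> s0 \<in> B"
    using d(1) by (auto simp: I_def)
  define b where "b = a [^] d \<otimes> s0"
  have b: "b \<in> B" "b \<in> carrier G"
    using s0 by (auto simp: b_def)
  have bc: "b \<in> group_centre G"
  proof -
    have "generate G S \<subseteq> group_centre G"
      using insert.prems by (intro generate_subgroup_incl subgroup_group_centre) auto
    then show ?thesis
      using s0(1) ak[of d] subgroup.m_closed[OF subgroup_group_centre] by (auto simp: b_def)
  qed
  have "B \<subseteq> generate G (insert b T)"
  proof
    fix x assume x: "x \<in> B"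
    obtain k :: int and s where s: "s \<in> generate G S" "x = a [^] k \<otimes> s"
      using x insert.prems(3) generate_insert_central[OF a(1) S] by blast
    then have "k \<in> I"
      using x by (auto simp: I_def)
    then obtain j where j: "k = d * j"
      using d(2) by blast
    \<comment> \<open>Dividing by this power of \<open>b\<close> cancels the power of
      \<open>a\<close>, which leaves an element of \<open>B'\<close>.\<close>
    define y where "y = inv (b [^] j) \<otimes> x"
    have "b [^] j = a [^] k \<otimes> s0 [^] j"
      using int_pow_mult_distrib[OF centre_commute[OF ak[of d]], of s0 j] a s0(1)
      by (simp add: b_def j int_pow_pow)
    then have "y = inv (s0 [^] j) \<otimes> s"
      using a s0 s by (simp add: y_def inv_mult_group m_assoc inv_mult_cancel)
    then have "y \<in> generate G S"
      using s0 s by (simp add: subgroup_int_pow_closed[OF S.is_subgroup])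
    moreover have "y \<in> B"
      using x b by (simp add: y_def subgroup_int_pow_closed[OF B.is_subgroup])
    ultimately have "y \<in> generate G (insert b T)"
      using T(3) mono_generate[of T "insert b T"] by (auto simp: B'_def)
    moreover have "b [^] j \<in> generate G (insert b T)"
      using b T by (intro subgroup_int_pow_closed generate_is_subgroup) (auto intro: generate.incl)
    moreover have "x = b [^] j \<otimes> y"
      using x b by (simp add: y_def inv_mult_cancel)
    ultimately show "x \<in> generate G (insert b T)"
      by (auto intro: generate.eng)
  qed
  moreover have "generate G (insert b T) \<subseteq> B"
    using TB b by (intro generate_subgroup_incl[OF _ B.is_subgroup]) auto
  ultimately show ?case
    using T(1,2) b by (auto simp: fg_subgroups_iff intro!: exI[of _ "insert b T"])
qed

end

lemma (in group_hom) fg_subgroups_img: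
  assumes "K \<in> fg_subgroups G"
  shows "h ` K \<in> fg_subgroups H"
proof -
  obtain S where "finite S" "S \<subseteq> carrier G" "K = generate G S"
    using assms by (auto simp: G.fg_subgroups_iff)
  then show ?thesis
    by (auto simp: H.fg_subgroups_iff intro!: exI[of _ "h ` S"] simp flip: generate_img)
qed

section \<open>Products of subsets\<close>

lemma set_product_Nil [simp]: "set_product G [] = {\<one>\<^bsub>G\<^esub>}"
  and set_product_Cons: "set_product G (H # Hs) = H <#>\<^bsub>G\<^esub> set_product G Hs"
  by (simp_all add: set_product_def)

context group
begin

lemma set_product_closed: "\<forall>H\<in>set Hs. H \<subseteq> carrier G \<Longrightarrow> set_product G Hs \<subseteq> carrier G"
  by (induction Hs) (auto simp: set_product_Cons set_mult_def)

lemma set_product_append: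
  assumes "\<forall>H\<in>set Hs \<union> set Ks. H \<subseteq> carrier G"
  shows "set_product G (Hs @ Ks) = set_product G Hs <#> set_product G Ks"
  using assms
proof (induction Hs)
  case Nil
  then show ?case
    using set_product_closed[of Ks] by (force simp: set_mult_def)
next
  case (Cons H Hs)
  then show ?case
    using set_product_closed[of Hs] set_product_closed[of Ks]
    by (simp add: set_product_Cons set_mult_assoc)
qed

lemma fg_subgroupsD:
  assumes "H \<in> fg_subgroups G"
  shows "subgroup H G" "H \<subseteq> carrier G"
  using assms by (auto simp: fg_subgroups_def dest: subgroup.subset)

end

lemma (in group_hom) set_product_img:
  assumes "\<forall>K\<in>set Ks. K \<subseteq> carrier G"
  shows "h ` set_product G Ks = set_product H (map ((`) h) Ks)"
  using assms
  by (induction Ks) (simp_all add: set_product_Cons set_mult_hom[OF homh] G.set_product_closed)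

text \<open>Viewing conjugation as a homomorphism makes the results on images of products and of
  finitely generated subgroups apply to conjugates.\<close>

lemma (in group) group_hom_conj:
  assumes "r \<in> carrier G"
  shows "group_hom G G (\<lambda>x. inv r \<otimes> x \<otimes> r)"
  using assms by unfold_locales (auto simp: hom_def m_assoc inv_mult_cancel)

section \<open>Products intersected with cosets of finite index subgroups\<close>

context group
begin

lemma r_coset_eq_l_coset_conj:
  assumes "S \<subseteq> carrier G" "r \<in> carrier G"
  shows "S #> r = r <# ((\<lambda>x. inv r \<otimes> x \<otimes> r) ` S)"
proof -
  have "x \<otimes> r = r \<otimes> (inv r \<otimes> x \<otimes> r)" if "x \<in> S" for x
    using that assms by (simp add: m_assoc inv_mult_cancel subset_iff)
  then show ?thesis
    by (simp add: r_coset_def l_coset_def)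
qed

text \<open>A constant is pulled to the left past \<open>L\<close> at the cost of conjugating
  \<open>L\<close>, so the result is again a translate of a product of the same shape.\<close>

lemma set_mult_l_coset_set_product:
  assumes "L \<subseteq> carrier G" "x \<in> carrier G" "\<forall>K\<in>set Ks. K \<subseteq> carrier G"
  shows "L <#> (x <# set_product G Ks) = x <# set_product G ((\<lambda>y. inv x \<otimes> y \<otimes> x) ` L # Ks)"
proof -
  have c: "(\<lambda>y. inv x \<otimes> y \<otimes> x) ` L \<subseteq> carrier G"
    using assms by auto
  show ?thesis
    using assms c set_product_closed[OF assms(3)]
    by (simp add: set_product_Cons setmult_lcos_assoc r_coset_eq_l_coset_conj flip: rcos_assoc_lcos)
qed

lemma conj_fg_subgroups:
  assumes "r \<in> carrier G" "K \<in> fg_subgroups G"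
  shows "(\<lambda>x. inv r \<otimes> x \<otimes> r) ` K \<in> fg_subgroups G"
  using group_hom.fg_subgroups_img[OF group_hom_conj] assms by blast

lemma r_coset_set_product:
  assumes "r \<in> carrier G" "\<forall>K\<in>set Ks. K \<subseteq> carrier G"
  shows "set_product G Ks #> r = r <# set_product G (map ((`) (\<lambda>x. inv r \<otimes> x \<otimes> r)) Ks)"
  using assms
  by (simp add: r_coset_eq_l_coset_conj set_product_closed group_hom.set_product_img[OF group_hom_conj])

text \<open>Each \<open>k\<close> in \<open>K\<close> splits as \<open>k \<otimes> inv t\<close> in
  \<open>K \<inter> N\<close> times a representative \<open>t\<close>; modulo \<open>N\<close> only
  \<open>t\<close> matters, which determines the coset in which the rest of the product must
  lie.\<close>

lemma set_product_Cons_Int_r_coset: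
  assumes N: "N \<lhd> G" and K: "subgroup K G" and P: "P \<subseteq> carrier G" and g: "g \<in> carrier G"
    and T: "T \<subseteq> K" "\<And>k. k \<in> K \<Longrightarrow> \<exists>t\<in>T. k \<otimes> inv t \<in> N"
  shows "(K <#> P) \<inter> (N #> g) = (\<Union>t\<in>T. (K \<inter> N) <#> (t <# (P \<inter> (N #> (inv t \<otimes> g)))))"
proof -
  interpret N: normal N G by (rule N)
  interpret K: subgroup K G by (rule K)
  \<comment> \<open>Modulo \<open>N\<close> both sides say that \<open>t \<otimes> p\<close> equals
    \<open>g\<close>.\<close>
  have shift: "p \<in> N #> (inv t \<otimes> g) \<longleftrightarrow> n \<otimes> t \<otimes> p \<in> N #> g"
    if "t \<in> K" "p \<in> P" "n \<in> N" for t p n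
  proof -
    have c: "t \<in> carrier G" "p \<in> carrier G" "n \<in> carrier G"
      using that P by auto
    have 1: "p \<otimes> inv g \<otimes> t \<in> N \<longleftrightarrow> t \<otimes> (p \<otimes> inv g \<otimes> t) \<otimes> inv t \<in> N"
    proof
      assume "t \<otimes> (p \<otimes> inv g \<otimes> t) \<otimes> inv t \<in> N"
      then have "inv t \<otimes> (t \<otimes> (p \<otimes> inv g \<otimes> t) \<otimes> inv t) \<otimes> t \<in> N"
        using c by (intro N.inv_op_closed1)
      then show "p \<otimes> inv g \<otimes> t \<in> N"
        using c g by (simp add: m_assoc inv_mult_cancel)
    qed (use c N.inv_op_closed2 in blast)
    have 2: "t \<otimes> p \<otimes> inv g \<in> N \<longleftrightarrow> n \<otimes> (t \<otimes> p \<otimes> inv g) \<in> N"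
    proof
      assume "n \<otimes> (t \<otimes> p \<otimes> inv g) \<in> N"
      then have "inv n \<otimes> (n \<otimes> (t \<otimes> p \<otimes> inv g)) \<in> N"
        using that by blast
      then show "t \<otimes> p \<otimes> inv g \<in> N"
        using c g by (simp add: inv_mult_cancel)
    qed (use that in blast)
    have "p \<in> N #> (inv t \<otimes> g) \<longleftrightarrow> p \<otimes> inv g \<otimes> t \<in> N"
      using c g by (simp add: mem_r_coset_iff N.is_subgroup inv_mult_group m_assoc)
    also have "\<dots> \<longleftrightarrow> t \<otimes> p \<otimes> inv g \<in> N"
      unfolding 1 using c g by (simp add: m_assoc)
    also have "\<dots> \<longleftrightarrow> n \<otimes> t \<otimes> p \<in> N #> g"
      unfolding 2 using c g by (simp add: mem_r_coset_iff N.is_subgroup m_assoc)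
    finally show ?thesis .
  qed
  show ?thesis
  proof (intro equalityI subsetI)
    fix x assume x: "x \<in> (K <#> P) \<inter> (N #> g)"
    then obtain k p where kp: "k \<in> K" "p \<in> P" "x = k \<otimes> p"
      by (auto simp: set_mult_def)
    obtain t where t: "t \<in> T" "k \<otimes> inv t \<in> N"
      using T(2) kp(1) by blast
    have tK: "t \<in> K" using t T by blast
    have x_eq: "x = (k \<otimes> inv t) \<otimes> t \<otimes> p" "x = (k \<otimes> inv t) \<otimes> (t \<otimes> p)"
      using kp tK P by (auto simp: m_assoc inv_mult_cancel subset_iff)
    then have "p \<in> N #> (inv t \<otimes> g)"
      using shift[OF tK kp(2) t(2)] x by simp
    moreover have "k \<otimes> inv t \<in> K \<inter> N"
      using kp tK t by simp
    ultimately show "x \<in> (\<Union>t\<in>T. (K \<inter> N) <#> (t <# (P \<inter> (N #> (inv t \<otimes> g)))))"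
      using t(1) kp(2) x_eq(2) by (auto simp: set_mult_def l_coset_def)
  next
    fix x assume "x \<in> (\<Union>t\<in>T. (K \<inter> N) <#> (t <# (P \<inter> (N #> (inv t \<otimes> g)))))"
    then obtain t n p where *: "t \<in> T" "n \<in> K" "n \<in> N" "p \<in> P" "p \<in> N #> (inv t \<otimes> g)"
      "x = n \<otimes> (t \<otimes> p)"
      by (auto simp: set_mult_def l_coset_def)
    have tK: "t \<in> K" using * T by blast
    have x_eq: "x = n \<otimes> t \<otimes> p"
      using * tK P by (simp add: m_assoc subset_iff)
    then have "x \<in> N #> g"
      using shift[OF tK *(4,3)] * by simp
    moreover have "x \<in> K <#> P"
      using * tK K.m_closed[of n t] unfolding x_eq set_mult_def by blast
    ultimately show "x \<in> (K <#> P) \<inter> (N #> g)" by blast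
  qed
qed

text \<open>Induction on the factors: the first one is cut into finitely many pieces
  \<open>(K \<inter> N) #> t\<close>, and Schreier's lemma keeps \<open>K \<inter> N\<close>
  finitely generated. Preserving the number of factors guarantees that a nonempty product yields
  nonempty products.\<close>

lemma set_product_Int_r_coset:
  assumes N: "N \<lhd> G" "finite (rcosets N)"
    and "set Ks \<subseteq> fg_subgroups G" "g \<in> carrier G"
  shows "\<exists>F. finite F \<and> F \<subseteq> carrier G \<times> {Ls. length Ls = length Ks \<and> set Ls \<subseteq> fg_subgroups G} \<and>
    set_product G Ks \<inter> (N #> g) = (\<Union>(x, Ls)\<in>F. x <# set_product G Ls)"
  using assms(3,4)
proof (induction Ks arbitrary: g)
  case Nil
  show ?case
  proof (cases "\<one> \<in> N #> g")
    case True
    then show ?thesis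
      by (intro exI[of _ "{(\<one>, [])}"]) (auto simp: l_coset_def)
  next
    case False
    then show ?thesis
      by (intro exI[of _ "{}"]) auto
  qed
next
  case (Cons K Ks)
  have sN: "subgroup N G"
    using N by (simp add: normal_imp_subgroup)
  have K: "K \<in> fg_subgroups G" "subgroup K G" "K \<subseteq> carrier G" and Ks: "set Ks \<subseteq> fg_subgroups G"
    using Cons.prems fg_subgroupsD by auto
  obtain T where T: "finite T" "T \<subseteq> K" "\<And>k. k \<in> K \<Longrightarrow> \<exists>t\<in>T. k \<otimes> inv t \<in> N"
    using finite_transversal[OF sN N(2) K(3)] by blast
  have Tc: "t \<in> carrier G" if "t \<in> T" for t
    using T K that by auto
  have L: "K \<inter> N \<in> fg_subgroups G"
    by (rule fg_subgroup_Int_finite_index[OF K(1) sN N(2)])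
  \<comment> \<open>Naming the conclusion of the induction hypothesis allows one decomposition
    \<open>F t\<close> to be chosen for every representative \<open>t\<close>.\<close>
  define good where "good t F \<longleftrightarrow> finite F
      \<and> F \<subseteq> carrier G \<times> {Ls. length Ls = length Ks \<and> set Ls \<subseteq> fg_subgroups G}
      \<and> set_product G Ks \<inter> (N #> (inv t \<otimes> g)) = (\<Union>(x, Ls)\<in>F. x <# set_product G Ls)" for t F
  have "\<forall>t\<in>T. \<exists>F. good t F"
    unfolding good_def using Cons.prems Tc by (intro ballI Cons.IH) auto
  then obtain F where "\<forall>t\<in>T. good t (F t)"
    by (rule bchoice[THEN exE])
  then have F: "\<And>t. t \<in> T \<Longrightarrow> finite (F t)"
    "\<And>t. t \<in> T \<Longrightarrow> F t \<subseteq> carrier G \<times> {Ls. length Ls = length Ks \<and> set Ls \<subseteq> fg_subgroups G}"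
    "\<And>t. t \<in> T \<Longrightarrow> set_product G Ks \<inter> (N #> (inv t \<otimes> g)) = (\<Union>(x, Ls)\<in>F t. x <# set_product G Ls)"
    by (simp_all add: good_def)
  define c where "c = (\<lambda>r. (`) (\<lambda>x. inv r \<otimes> x \<otimes> r))"
  \<comment> \<open>The two translations combine to \<open>t \<otimes> x\<close>, which moves to the
    left of \<open>K \<inter> N\<close> and conjugates it.\<close>
  define F' where "F' = (\<Union>t\<in>T. (\<lambda>(x, Ls). (t \<otimes> x, c (t \<otimes> x) (K \<inter> N) # Ls)) ` F t)"
  have step: "(K \<inter> N) <#> (t <# (x <# set_product G Ls))
      = (t \<otimes> x) <# set_product G (c (t \<otimes> x) (K \<inter> N) # Ls)"
    if "t \<in> T" "(x, Ls) \<in> F t" for t x Ls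
  proof -
    have "x \<in> carrier G" "set Ls \<subseteq> fg_subgroups G"
      using F(2)[OF that(1)] that(2) by auto
    then have x: "x \<in> carrier G" "\<forall>K\<in>set Ls. K \<subseteq> carrier G"
      by (auto dest: fg_subgroupsD)
    have "t <# (x <# set_product G Ls) = (t \<otimes> x) <# set_product G Ls"
      using x Tc[OF that(1)] set_product_closed[OF x(2)] by (simp add: lcos_m_assoc)
    then show ?thesis
      unfolding c_def using x Tc[OF that(1)] K by (simp add: set_mult_l_coset_set_product le_infI1)
  qed
  have Pc: "set_product G Ks \<subseteq> carrier G"
    using Ks fg_subgroupsD by (intro set_product_closed) auto
  have "set_product G (K # Ks) \<inter> (N #> g)
      = (\<Union>t\<in>T. (K \<inter> N) <#> (t <# (set_product G Ks \<inter> (N #> (inv t \<otimes> g)))))"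
    unfolding set_product_Cons
    using Cons.prems by (intro set_product_Cons_Int_r_coset N K Pc T) auto
  also have "\<dots> = (\<Union>t\<in>T. (K \<inter> N) <#> (t <# (\<Union>(x, Ls)\<in>F t. x <# set_product G Ls)))"
    using F(3) by simp
  also have "\<dots> = (\<Union>t\<in>T. \<Union>(x, Ls)\<in>F t. (K \<inter> N) <#> (t <# (x <# set_product G Ls)))"
    by (fastforce simp: set_mult_def l_coset_def)
  also have "\<dots> = (\<Union>t\<in>T. \<Union>(x, Ls)\<in>F t. (t \<otimes> x) <# set_product G (c (t \<otimes> x) (K \<inter> N) # Ls))"
    using step by (intro SUP_cong refl) auto
  also have "\<dots> = (\<Union>(x, Ls)\<in>F'. x <# set_product G Ls)"
    by (simp add: F'_def case_prod_unfold)
  finally have eq: "set_product G (K # Ks) \<inter> (N #> g) = (\<Union>(x, Ls)\<in>F'. x <# set_product G Ls)" .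
  have "finite F'"
    using T(1) F(1) by (simp add: F'_def)
  moreover have "F' \<subseteq> carrier G \<times> {Ls. length Ls = length (K # Ks) \<and> set Ls \<subseteq> fg_subgroups G}"
  proof
    fix y assume "y \<in> F'"
    then obtain t x Ls where y: "t \<in> T" "(x, Ls) \<in> F t" "y = (t \<otimes> x, c (t \<otimes> x) (K \<inter> N) # Ls)"
      by (auto simp: F'_def)
    have "x \<in> carrier G" "length Ls = length Ks" "set Ls \<subseteq> fg_subgroups G"
      using F(2)[OF y(1)] y(2) by auto
    moreover have "c (t \<otimes> x) (K \<inter> N) \<in> fg_subgroups G"
      unfolding c_def using L Tc[OF y(1)] \<open>x \<in> carrier G\<close> by (intro conj_fg_subgroups) auto
    ultimately show "y \<in> carrier G \<times> {Ls. length Ls = length (K # Ks) \<and> set Ls \<subseteq> fg_subgroups G}"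
      using Tc[OF y(1)] y(3) by simp
  qed
  ultimately show ?case
    using eq by blast
qed

end

section \<open>Products stable under a finite index part of the kernel\<close>

context group_hom
begin

text \<open>The part of the product in the coset is a finite union of translated products of
  finitely generated subgroups, and this form survives in \<open>H\<close>, where such products are
  separable.\<close>

lemma separable_set_product_img_Int_r_coset:
  assumes H: "product_separable H" and N: "N \<lhd> G" "finite (rcosets N)"
    and Ks: "Ks \<noteq> []" "set Ks \<subseteq> fg_subgroups G" and g: "g \<in> carrier G"
  shows "separable_in H (h ` (set_product G Ks \<inter> (N #> g)))"
proof -
  obtain F where F: "finite F"
    "F \<subseteq> carrier G \<times> {Ls. length Ls = length Ks \<and> set Ls \<subseteq> fg_subgroups G}"
    "set_product G Ks \<inter> (N #> g) = (\<Union>(x, Ls)\<in>F. x <# set_product G Ls)"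
    using G.set_product_Int_r_coset[OF N Ks(2) g] by blast
  have "separable_in H (h ` (x <# set_product G Ls))" if "(x, Ls) \<in> F" for x Ls
  proof -
    have x: "x \<in> carrier G" "length Ls = length Ks" "set Ls \<subseteq> fg_subgroups G"
      using F(2) that by auto
    have Lc: "\<forall>K\<in>set Ls. K \<subseteq> carrier G"
      using x(3) G.fg_subgroupsD by auto
    have "h ` (x <# set_product G Ls) = h x <#\<^bsub>H\<^esub> h ` set_product G Ls"
      using x(1) G.set_product_closed[OF Lc] by (force simp: l_coset_def)
    also have "\<dots> = h x <#\<^bsub>H\<^esub> set_product H (map ((`) h) Ls)"
      by (simp add: set_product_img[OF Lc])
    finally have eq: "h ` (x <# set_product G Ls) = h x <#\<^bsub>H\<^esub> set_product H (map ((`) h) Ls)" .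
    have "separable_in H (set_product H (map ((`) h) Ls))"
    proof (intro H[unfolded product_separable_def, rule_format] conjI)
      show "map ((`) h) Ls \<noteq> []"
        using x(2) Ks(1) by auto
      show "set (map ((`) h) Ls) \<subseteq> fg_subgroups H"
        using x(3) by (auto intro: fg_subgroups_img)
    qed
    then show ?thesis
      unfolding eq using x(1) by (simp add: H.separable_in_l_coset)
  qed
  then have "separable_in H (\<Union>((\<lambda>(x, Ls). h ` (x <# set_product G Ls)) ` F))"
    using F(1) by (intro H.separable_in_Union) auto
  also have "\<Union>((\<lambda>(x, Ls). h ` (x <# set_product G Ls)) ` F) = h ` (set_product G Ks \<inter> (N #> g))"
    unfolding F(3) by (auto simp: image_UN)
  finally show ?thesis .
qed

text \<open>The stability hypothesis makes \<open>h\<close> separate points of \<open>N #> g\<close> from the product.\<close>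

lemma separable_set_product_kernel_stable:
  assumes H: "product_separable H" and N: "N \<lhd> G" "finite (rcosets N)"
    and Ks: "Ks \<noteq> []" "set Ks \<subseteq> fg_subgroups G"
    and stable: "\<And>p z. \<lbrakk>p \<in> set_product G Ks; z \<in> N; z \<in> kernel G H h\<rbrakk> \<Longrightarrow> p \<otimes> z \<in> set_product G Ks"
  shows "separable_in G (set_product G Ks)"
  unfolding G.separable_in_iff
proof (intro conjI ballI)
  let ?P = "set_product G Ks"
  interpret N: normal N G by (rule N)
  show Pc: "?P \<subseteq> carrier G"
    using Ks(2) G.fg_subgroupsD by (intro G.set_product_closed) auto
  fix g assume g: "g \<in> carrier G - ?P"
  \<comment> \<open>A point \<open>p\<close> of the product in \<open>N #> g\<close> with the same
    image would differ from \<open>g\<close> by an element of \<open>N\<close> in the kernel, and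
    stability would put \<open>g\<close> in the product.\<close>
  have "h g \<notin> h ` (?P \<inter> (N #> g))"
  proof
    assume "h g \<in> h ` (?P \<inter> (N #> g))"
    then obtain p where p: "p \<in> ?P" "p \<in> N #> g" "h g = h p"
      by blast
    then obtain n where n: "n \<in> N" "p = n \<otimes> g"
      by (auto simp: r_coset_def)
    have c: "p \<in> carrier G" "g \<in> carrier G" "n \<in> carrier G"
      using p(1) Pc g n by auto
    have "inv p \<otimes> g = inv g \<otimes> inv n \<otimes> g"
      using c by (simp add: n(2) G.inv_mult_group)
    then have "inv p \<otimes> g \<in> N"
      using N.inv_op_closed1 c n by simp
    moreover have "inv p \<otimes> g \<in> kernel G H h"
      using c p(3) by (simp add: kernel_def)
    ultimately have "p \<otimes> (inv p \<otimes> g) \<in> ?P"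
      using stable p(1) by blast
    then show False
      using c g by (simp add: G.inv_mult_cancel)
  qed
  with separate_via_hom[OF separable_set_product_img_Int_r_coset[OF H N Ks, of g]] g
  obtain M where M: "M \<lhd> G" "finite (rcosets M)" "\<And>x. x \<in> M #> g \<Longrightarrow> h x \<notin> h ` (?P \<inter> (N #> g))"
    by blast
  \<comment> \<open>\<open>N\<close> confines a common point to \<open>?P \<inter> (N #> g)\<close>,
    and \<open>M\<close> keeps its image away from the image of that set.\<close>
  have "((M \<inter> N) #> g) \<inter> ?P = {}"
    using M(3) by (fastforce simp: r_coset_def)
  then show "\<exists>N. N \<lhd> G \<and> finite (rcosets N) \<and> (N #> g) \<inter> ?P = {}"
    using G.finite_index_Int[OF M(1,2) N] by blast
qed

end

section \<open>Lifting equivalent product representatives\<close>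

lemma (in group) foldr_mult_closed:
  "set xs \<subseteq> carrier G \<Longrightarrow> foldr (\<otimes>) xs \<one> \<in> carrier G"
  by (induction xs) auto

lemma (in group) foldr_mult_append:
  "\<lbrakk>set xs \<subseteq> carrier G; set ys \<subseteq> carrier G\<rbrakk>
    \<Longrightarrow> foldr (\<otimes>) (xs @ ys) \<one> = foldr (\<otimes>) xs \<one> \<otimes> foldr (\<otimes>) ys \<one>"
  by (induction xs) (auto simp: m_assoc foldr_mult_closed)

lemma (in group_hom) hom_foldr_mult:
  "set xs \<subseteq> carrier G
    \<Longrightarrow> h (foldr (\<otimes>) xs \<one>) = foldr (\<lambda>x y. x \<otimes>\<^bsub>H\<^esub> y) (map h xs) \<one>\<^bsub>H\<^esub>"
  by (induction xs) (auto simp: G.foldr_mult_closed)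

lemma set_product_eq_foldr:
  "set_product G Ks = (\<lambda>hs. foldr (\<lambda>x y. x \<otimes>\<^bsub>G\<^esub> y) hs \<one>\<^bsub>G\<^esub>) ` listset Ks"
  using set_product_iff[of _ G Ks] by (auto simp: product_reps_def)

lemma listset_subset_carrier:
  assumes "hs \<in> listset Ks" "\<forall>K\<in>set Ks. K \<subseteq> A"
  shows "set hs \<subseteq> A"
proof
  fix x assume "x \<in> set hs"
  then obtain i where "i < length hs" "x = hs ! i"
    by (auto simp: in_set_conv_nth)
  then have "x \<in> Ks ! i" "Ks ! i \<in> set Ks"
    using assms(1) by (simp_all add: listset_iff)
  then show "x \<in> A"
    using assms(2) by blast
qed

text \<open>This is a central extension seen from its quotient map: the group \<open>Z\<close>
  survives only as the kernel.\<close>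

locale central_group_hom = group_hom +
  assumes kernel_central: "kernel G H h \<subseteq> group_centre G"
begin

lemma kernelD:
  assumes "z \<in> kernel G H h"
  shows "z \<in> carrier G" "h z = \<one>\<^bsub>H\<^esub>" "\<And>x. x \<in> carrier G \<Longrightarrow> z \<otimes> x = x \<otimes> z"
  using assms kernel_central G.centre_commute by (auto simp: kernel_def)

text \<open>If \<open>s i\<close> lifts to \<open>t\<close> in the factor \<open>i - 1\<close> and to \<open>t'\<close> in the factor \<open>i\<close>, then conjugating
  the representative by these lifts changes its product by the central elements \<open>inv t \<otimes> t'\<close>.\<close>

lemma lift_equivalent_rep:
  assumes "\<forall>K\<in>set Ks. subgroup K G" "Ks \<noteq> []" "subgroup W G" "W \<subseteq> kernel G H h"
    and "hs \<in> listset Ks" "length ks = length Ks" "set ks \<subseteq> carrier H"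
    and "t0 \<in> Ks ! 0" "h t0 = s 0" "s (length Ks) = \<one>\<^bsub>H\<^esub>"
    and "\<forall>i. Suc i < length Ks \<longrightarrow> s (Suc i) \<in> h ` (Ks ! i) \<inter> h ` (Ks ! Suc i)"
    and "\<forall>i<length Ks. s i \<otimes>\<^bsub>H\<^esub> ks ! i = h (hs ! i) \<otimes>\<^bsub>H\<^esub> s (Suc i)"
    and "\<forall>i. Suc i < length Ks \<longrightarrow>
      (\<forall>t\<in>Ks ! i. \<forall>t'\<in>Ks ! Suc i. h t = h t' \<longrightarrow> inv t \<otimes> t' \<in> W)"
  shows "\<exists>ls\<in>listset Ks. map h ls = ks \<and>
    (\<exists>w\<in>W. foldr (\<otimes>) hs \<one> = t0 \<otimes> foldr (\<otimes>) ls \<one> \<otimes> w)"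
  using assms
proof (induction Ks arbitrary: hs ks t0 s)
  case Nil
  then show ?case by simp
next
  case (Cons K Ks)
  interpret K: subgroup K G using Cons.prems by simp
  interpret W: subgroup W G using Cons.prems by simp
  obtain g gs where hs: "hs = g # gs" "g \<in> K" "gs \<in> listset Ks"
    using Cons.prems(5) by (auto simp: set_Cons_def)
  obtain k ks' where ks: "ks = k # ks'" "length ks' = length Ks" "k \<in> carrier H" "set ks' \<subseteq> carrier H"
    using Cons.prems(6,7) by (cases ks) auto
  have t0: "t0 \<in> K" using Cons.prems by simp
  have first: "s 0 \<otimes>\<^bsub>H\<^esub> k = h g \<otimes>\<^bsub>H\<^esub> s (Suc 0)"
    using Cons.prems(12)[rule_format, of 0] by (simp add: hs ks)
  \<comment> \<open>This solves the first equivalence relation for \<open>k\<close> upstairs. Every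
    lift \<open>t\<close> of \<open>s 1\<close> in \<open>K\<close> is allowed, and the solution
    stays in \<open>K\<close>.\<close>
  have lift: "h (inv t0 \<otimes> g \<otimes> t) = k" if "t \<in> K" "h t = s (Suc 0)" for t
  proof -
    have "h (inv t0 \<otimes> g \<otimes> t) = inv\<^bsub>H\<^esub> (h t0) \<otimes>\<^bsub>H\<^esub> (h g \<otimes>\<^bsub>H\<^esub> h t)"
      using that(1) t0 hs(2) by (simp add: H.m_assoc)
    also have "h g \<otimes>\<^bsub>H\<^esub> h t = h t0 \<otimes>\<^bsub>H\<^esub> k"
      by (simp add: that(2) first Cons.prems(9))
    also have "inv\<^bsub>H\<^esub> (h t0) \<otimes>\<^bsub>H\<^esub> (h t0 \<otimes>\<^bsub>H\<^esub> k) = k"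
      using t0 ks(3) by (simp add: H.inv_mult_cancel)
    finally show ?thesis .
  qed
  show ?case
  proof (cases "Ks = []")
    case True
    have "s (Suc 0) = \<one>\<^bsub>H\<^esub>" using Cons.prems(10) True by simp
    then have "map h [inv t0 \<otimes> g] = ks"
      using lift[of \<one>] True t0 hs(2) ks by simp
    moreover have "[inv t0 \<otimes> g] \<in> listset (K # Ks)"
      using t0 hs(2) True by (simp add: set_Cons_def)
    moreover have "foldr (\<otimes>) hs \<one> = t0 \<otimes> foldr (\<otimes>) [inv t0 \<otimes> g] \<one> \<otimes> \<one>"
      using hs t0 True by (simp add: G.inv_mult_cancel)
    ultimately show ?thesis
      using W.one_closed by blast
  next
    case False
    then have "s (Suc 0) \<in> h ` K \<inter> h ` (Ks ! 0)"
      using Cons.prems(11)[rule_format, of 0] by simp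
    \<comment> \<open>The same element is lifted twice, to the current factor and to the next one.
      The discrepancy \<open>inv t \<otimes> t'\<close> lies in \<open>W\<close> by
      hypothesis.\<close>
    then obtain t t' where t: "t \<in> K" "h t = s (Suc 0)" and t': "t' \<in> Ks ! 0" "h t' = s (Suc 0)"
      by (metis IntE imageE)
    have KsI: "i < length Ks \<Longrightarrow> subgroup (Ks ! i) G" for i
      using Cons.prems(1) by simp
    have t'c: "t' \<in> carrier G"
      using KsI[of 0] False t' subgroup.mem_carrier by fastforce
    have "\<exists>ls\<in>listset Ks. map h ls = ks' \<and>
        (\<exists>w\<in>W. foldr (\<otimes>) gs \<one> = t' \<otimes> foldr (\<otimes>) ls \<one> \<otimes> w)"
    \<comment> \<open>After the shift the sequence starts at \<open>s 1\<close>, with lift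
      \<open>t'\<close>. For this reason the statement allows a start \<open>t0\<close> over an
      arbitrary \<open>s 0\<close>.\<close>
    proof (rule Cons.IH[where s = "s \<circ> Suc"])
      show "\<forall>i. Suc i < length Ks \<longrightarrow> (s \<circ> Suc) (Suc i) \<in> h ` (Ks ! i) \<inter> h ` (Ks ! Suc i)"
        using Cons.prems(11) by (metis Suc_less_eq comp_apply length_Cons nth_Cons_Suc)
      show "\<forall>i<length Ks. (s \<circ> Suc) i \<otimes>\<^bsub>H\<^esub> ks' ! i = h (gs ! i) \<otimes>\<^bsub>H\<^esub> (s \<circ> Suc) (Suc i)"
        using Cons.prems(12) by (metis Suc_less_eq comp_apply length_Cons nth_Cons_Suc hs(1) ks(1))
      show "\<forall>i. Suc i < length Ks \<longrightarrow>
          (\<forall>t\<in>Ks ! i. \<forall>t'\<in>Ks ! Suc i. h t = h t' \<longrightarrow> inv t \<otimes> t' \<in> W)"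
        using Cons.prems(13) by (metis Suc_less_eq length_Cons nth_Cons_Suc)
    qed (use Cons.prems(1-4,10) False hs ks t' in auto)
    then obtain ls w where ls: "ls \<in> listset Ks" "map h ls = ks'" "w \<in> W"
      and gs: "foldr (\<otimes>) gs \<one> = t' \<otimes> foldr (\<otimes>) ls \<one> \<otimes> w"
      by blast
    define l where "l = inv t0 \<otimes> g \<otimes> t"
    define p where "p = foldr (\<otimes>) ls \<one>"
    have c: "inv t \<otimes> t' \<in> W"
      using Cons.prems(13)[rule_format, of 0 t t'] False t t' by simp
    have "set ls \<subseteq> carrier G"
      using ls(1) Cons.prems(1) by (intro listset_subset_carrier) (auto dest: subgroup.subset)
    then have p: "p \<in> carrier G"
      by (simp add: p_def G.foldr_mult_closed)
    have "foldr (\<otimes>) hs \<one> = g \<otimes> (t' \<otimes> p \<otimes> w)"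
      by (simp add: hs gs p_def)
    also have "\<dots> = g \<otimes> t \<otimes> ((inv t \<otimes> t') \<otimes> p) \<otimes> w"
      using hs(2) t t'c p ls(3) by (simp add: G.m_assoc G.inv_mult_cancel)
    also have "(inv t \<otimes> t') \<otimes> p = p \<otimes> (inv t \<otimes> t')"
      using c Cons.prems(4) p by (intro kernelD(3)) auto
    also have "g \<otimes> t \<otimes> (p \<otimes> (inv t \<otimes> t')) \<otimes> w = t0 \<otimes> (l \<otimes> p) \<otimes> (inv t \<otimes> t' \<otimes> w)"
      using hs(2) t(1) t0 t'c p ls(3) by (simp add: l_def G.m_assoc G.inv_mult_cancel)
    finally have "foldr (\<otimes>) hs \<one> = t0 \<otimes> foldr (\<otimes>) (l # ls) \<one> \<otimes> (inv t \<otimes> t' \<otimes> w)"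
      by (simp add: p_def)
    moreover have "l # ls \<in> listset (K # Ks)"
      using t0 hs(2) t(1) ls(1) by (simp add: l_def set_Cons_def)
    moreover have "map h (l # ls) = ks"
      using lift[OF t] ls(2) by (simp add: l_def ks(1))
    moreover have "inv t \<otimes> t' \<otimes> w \<in> W"
      using c ls(3) by (rule W.m_closed)
    ultimately show ?thesis
      by blast
  qed
qed

section \<open>The stabiliser of a product in the kernel\<close>

text \<open>Asking the same of \<open>inv z\<close> expresses that right multiplication by
  \<open>z\<close> maps \<open>P\<close> onto itself, for \<open>P\<close> inside the group, and
  makes the stabiliser closed under inverses.\<close>

definition kernel_stabiliser :: "'a set \<Rightarrow> 'a set" where
  "kernel_stabiliser P = {z \<in> kernel G H h. \<forall>p\<in>P. p \<otimes> z \<in> P \<and> p \<otimes> inv z \<in> P}"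

lemma subgroup_kernel_stabiliser:
  assumes "P \<subseteq> carrier G"
  shows "subgroup (kernel_stabiliser P) G"
proof -
  interpret Z: subgroup "kernel G H h" G by (rule subgroup_kernel)
  show ?thesis
  proof (rule G.subgroupI)
    show "kernel_stabiliser P \<noteq> {}"
      using assms by (auto simp: kernel_stabiliser_def subset_iff intro!: exI[of _ \<one>])
    fix a b assume ab: "a \<in> kernel_stabiliser P" "b \<in> kernel_stabiliser P"
    then have c: "a \<in> carrier G" "b \<in> carrier G" "a \<in> kernel G H h" "b \<in> kernel G H h"
      by (auto simp: kernel_stabiliser_def)
    have "p \<otimes> (a \<otimes> b) \<in> P \<and> p \<otimes> inv (a \<otimes> b) \<in> P" if p: "p \<in> P" for p
    proof -
      have "p \<otimes> (a \<otimes> b) = p \<otimes> a \<otimes> b" "p \<otimes> inv (a \<otimes> b) = p \<otimes> inv b \<otimes> inv a"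
        using p assms c by (auto simp: G.m_assoc G.inv_mult_group)
      then show ?thesis
        using ab p by (simp add: kernel_stabiliser_def)
    qed
    then show "a \<otimes> b \<in> kernel_stabiliser P"
      using c by (simp add: kernel_stabiliser_def)
  qed (auto simp: kernel_stabiliser_def)
qed

text \<open>Being central, \<open>z\<close> moves from the right end past \<open>Y\<close> to
  \<open>M\<close>, which absorbs it.\<close>

lemma kernel_stabiliserI:
  assumes z: "z \<in> kernel G H h" and P: "P = X <#> (M <#> Y)"
    and c: "X \<subseteq> carrier G" "M \<subseteq> carrier G" "Y \<subseteq> carrier G"
    and M: "\<And>m. m \<in> M \<Longrightarrow> m \<otimes> z \<in> M \<and> m \<otimes> inv z \<in> M"
  shows "z \<in> kernel_stabiliser P"
proof -
  have *: "x \<otimes> (m \<otimes> y) \<otimes> u \<in> P"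
    if "x \<in> X" "m \<in> M" "y \<in> Y" "u \<in> kernel G H h" "m \<otimes> u \<in> M" for x m y u
  proof -
    have "x \<otimes> (m \<otimes> y) \<otimes> u = x \<otimes> (m \<otimes> (y \<otimes> u))"
      using that c kernelD(1)[OF that(4)] by (simp add: G.m_assoc subset_iff)
    also have "y \<otimes> u = u \<otimes> y"
      using that c kernelD(3)[OF that(4), of y] by auto
    also have "x \<otimes> (m \<otimes> (u \<otimes> y)) = x \<otimes> ((m \<otimes> u) \<otimes> y)"
      using that c kernelD(1)[OF that(4)] by (simp add: G.m_assoc subset_iff)
    finally show ?thesis
      using that by (auto simp: P set_mult_def)
  qed
  have "inv z \<in> kernel G H h"
    using z subgroup.m_inv_closed[OF subgroup_kernel] by blast
  then show ?thesis
    using z M * by (auto simp: kernel_stabiliser_def P set_mult_def)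
qed

text \<open>By centrality, \<open>k \<otimes> l \<otimes> (inv t \<otimes> t')\<close> equals
  \<open>(k \<otimes> inv t) \<otimes> (t' \<otimes> l)\<close>: each half of the discrepancy is
  absorbed by its own factor.\<close>

lemma kernel_stabiliser_adjacent:
  assumes P: "P = X <#> ((K <#> L) <#> Y)" and c: "X \<subseteq> carrier G" "Y \<subseteq> carrier G"
    and K: "subgroup K G" and L: "subgroup L G"
    and t: "t \<in> K" "t' \<in> L" "h t = h t'"
  shows "inv t \<otimes> t' \<in> kernel_stabiliser P"
proof (rule kernel_stabiliserI[OF _ P c(1) _ c(2)])
  interpret K: subgroup K G by (rule K)
  interpret L: subgroup L G by (rule L)
  have c: "t \<in> carrier G" "t' \<in> carrier G"
    using t by auto
  show z: "inv t \<otimes> t' \<in> kernel G H h"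
    using c t(3) by (simp add: kernel_def)
  show "K <#> L \<subseteq> carrier G"
    by (simp add: G.setmult_subset_G K.subset L.subset)
  have *: "k \<otimes> l \<otimes> (inv u \<otimes> u') \<in> K <#> L"
    if "k \<in> K" "l \<in> L" "u \<in> K" "u' \<in> L" "inv u \<otimes> u' \<in> kernel G H h" for k l u u'
  proof -
    have "k \<otimes> l \<otimes> (inv u \<otimes> u') = k \<otimes> (l \<otimes> (inv u \<otimes> u'))"
      using that by (simp add: G.m_assoc)
    also have "l \<otimes> (inv u \<otimes> u') = (inv u \<otimes> u') \<otimes> l"
      using that(2) kernelD(3)[OF that(5)] by simp
    also have "k \<otimes> ((inv u \<otimes> u') \<otimes> l) = (k \<otimes> inv u) \<otimes> (u' \<otimes> l)"
      using that by (simp add: G.m_assoc)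
    finally show ?thesis
      using that unfolding set_mult_def by blast
  qed
  \<comment> \<open>A central element equals its conjugates, so the inverse has the same shape, with
    \<open>inv t\<close> and \<open>inv t'\<close> in place of \<open>t\<close> and
    \<open>t'\<close>.\<close>
  have inv: "inv (inv t \<otimes> t') = inv (inv t) \<otimes> inv t'"
  proof -
    have "inv (inv t \<otimes> t') = inv (t \<otimes> (inv t \<otimes> t') \<otimes> inv t)"
      using c by (simp add: G.m_assoc flip: kernelD(3)[OF z])
    also have "\<dots> = inv (inv t) \<otimes> inv t'"
      using c by (simp add: G.m_assoc G.inv_mult_cancel G.inv_mult_group)
    finally show ?thesis .
  qed
  have z': "inv (inv t) \<otimes> inv t' \<in> kernel G H h"
    using subgroup.m_inv_closed[OF subgroup_kernel z] by (simp only: inv)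
  fix m assume "m \<in> K <#> L"
  then obtain k l where "k \<in> K" "l \<in> L" "m = k \<otimes> l"
    by (auto simp: set_mult_def)
  then show "m \<otimes> (inv t \<otimes> t') \<in> K <#> L \<and> m \<otimes> inv (inv t \<otimes> t') \<in> K <#> L"
    unfolding inv using *[OF _ _ t(1,2) z] *[OF _ _ _ _ z'] t by simp
qed

end

section \<open>Products of subgroups in central extensions\<close>

context central_group_hom
begin

lemma fg_subgroups_subset_carrier: "set Ks \<subseteq> fg_subgroups G \<Longrightarrow> \<forall>K\<in>set Ks. K \<subseteq> carrier G"
  by (auto dest: G.fg_subgroupsD)

text \<open>These are the three kinds of central correction that occur when a point of
  \<open>P\<close> is compared with a lift of an equivalent representative: the factor
  \<open>A\<close>, two lifts of one entry, and two lifts of one \<open>s i\<close> in adjacent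
  factors.\<close>

lemma kernel_stabiliser_set_product:
  assumes Ks: "set Ks \<subseteq> fg_subgroups G" and A: "subgroup A G" "A \<subseteq> kernel G H h"
    and P: "P = set_product G Ks <#> A"
  shows "A \<subseteq> kernel_stabiliser P"
    and "\<And>i z. \<lbrakk>i < length Ks; z \<in> Ks ! i; z \<in> kernel G H h\<rbrakk> \<Longrightarrow> z \<in> kernel_stabiliser P"
    and "\<And>i t t'. \<lbrakk>Suc i < length Ks; t \<in> Ks ! i; t' \<in> Ks ! Suc i; h t = h t'\<rbrakk>
      \<Longrightarrow> inv t \<otimes> t' \<in> kernel_stabiliser P"
proof -
  note Kc = fg_subgroups_subset_carrier[OF Ks]
  have Ac: "A \<subseteq> carrier G"
    using A(1) by (rule subgroup.subset)
  have sub: "subgroup (Ks ! i) G" if "i < length Ks" for i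
    using Ks that G.fg_subgroupsD(1) nth_mem by blast
  have c: "set_product G (take i Ks) \<subseteq> carrier G" "set_product G (drop i Ks) <#> A \<subseteq> carrier G"
    "set_product G (drop i Ks) \<subseteq> carrier G" for i
    using Kc Ac by (auto intro!: G.setmult_subset_G G.set_product_closed
        dest: in_set_takeD in_set_dropD del: subsetI)
  have split: "P = set_product G (take i Ks) <#> (Ks ! i <#> (set_product G (drop (Suc i) Ks) <#> A))"
    if "i < length Ks" for i
  proof -
    have "set_product G Ks = set_product G (take i Ks @ Ks ! i # drop (Suc i) Ks)"
      using that by (simp add: id_take_nth_drop[symmetric])
    also have "\<dots> = set_product G (take i Ks) <#> (Ks ! i <#> set_product G (drop (Suc i) Ks))"
      using Kc that sub[OF that, THEN subgroup.subset]
      by (subst G.set_product_append) (auto simp: set_product_Cons dest: in_set_takeD in_set_dropD)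
    finally show ?thesis
      using c Ac sub[OF that, THEN subgroup.subset]
      by (simp add: P G.set_mult_assoc G.setmult_subset_G)
  qed
  show "A \<subseteq> kernel_stabiliser P"
  proof
    fix z assume z: "z \<in> A"
    show "z \<in> kernel_stabiliser P"
    \<comment> \<open>Here \<open>A\<close> is itself the absorbing factor, with nothing to its
      right.\<close>
    proof (rule kernel_stabiliserI[where Y = "{\<one>}"])
      have "A <#> {\<one>} = A"
        using Ac by (force simp: set_mult_def)
      then show "P = set_product G Ks <#> (A <#> {\<one>})"
        by (simp add: P)
      show "set_product G Ks \<subseteq> carrier G"
        by (rule G.set_product_closed[OF Kc])
    qed (use z A Ac in \<open>auto simp: subgroup.m_closed subgroup.m_inv_closed\<close>)
  qed
  show "z \<in> kernel_stabiliser P"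
    if "i < length Ks" "z \<in> Ks ! i" "z \<in> kernel G H h" for i z
  proof (rule kernel_stabiliserI[OF that(3) split[OF that(1)]])
    show "m \<otimes> z \<in> Ks ! i \<and> m \<otimes> inv z \<in> Ks ! i" if "m \<in> Ks ! i" for m
      using sub[OF \<open>i < length Ks\<close>] that \<open>z \<in> Ks ! i\<close>
      by (simp add: subgroup.m_closed subgroup.m_inv_closed)
  qed (use c sub[OF that(1), THEN subgroup.subset] in auto)
  show "inv t \<otimes> t' \<in> kernel_stabiliser P"
    if i: "Suc i < length Ks" and t: "t \<in> Ks ! i" "t' \<in> Ks ! Suc i" "h t = h t'" for i t t'
  proof (rule kernel_stabiliser_adjacent[OF _ c(1,2) _ _ t])
    have "drop (Suc i) Ks = Ks ! Suc i # drop (Suc (Suc i)) Ks"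
      using i by (simp add: Cons_nth_drop_Suc)
    then have "P = set_product G (take i Ks) <#>
        (Ks ! i <#> ((Ks ! Suc i <#> set_product G (drop (Suc (Suc i)) Ks)) <#> A))"
      using split[of i] i by (simp add: set_product_Cons)
    then show "P = set_product G (take i Ks) <#>
        ((Ks ! i <#> Ks ! Suc i) <#> (set_product G (drop (Suc (Suc i)) Ks) <#> A))"
      using c Ac sub[of i, THEN subgroup.subset] sub[OF i, THEN subgroup.subset] i
      by (simp add: G.set_mult_assoc G.setmult_subset_G)
  qed (use sub i in auto)
qed

text \<open>Products are unchanged by their stabiliser \<open>B\<close>, and equivalent representatives lift to
  products that agree modulo \<open>B\<close>. So the factor with finitely many values can be replaced by
  constants, which are then moved to the left by conjugation.\<close>

lemma fibre_as_shorter_products: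
  assumes bott: "bottlenecked_product_reps H (fg_subgroups H)"
    and Ks: "Ks \<noteq> []" "set Ks \<subseteq> fg_subgroups G" and A: "subgroup A G" "A \<subseteq> kernel G H h"
    and P: "P = set_product G Ks <#> A" and q: "q \<in> h ` set_product G Ks"
  obtains F B where "finite F"
    "F \<subseteq> carrier G \<times> {Ls. Suc (length Ls) = length Ks \<and> set Ls \<subseteq> fg_subgroups G}"
    "subgroup B G" "B \<subseteq> kernel G H h"
    "(\<Union>(x, Ls)\<in>F. x <# (set_product G Ls <#> B)) \<subseteq> P"
    "\<And>p. \<lbrakk>p \<in> P; h p = q\<rbrakk> \<Longrightarrow> p \<in> (\<Union>(x, Ls)\<in>F. x <# (set_product G Ls <#> B))"
proof -
  note Kc = fg_subgroups_subset_carrier[OF Ks(2)]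
  define B where "B = kernel_stabiliser P"
  have Pc: "P \<subseteq> carrier G"
    using A(1)[THEN subgroup.subset] by (simp add: P G.setmult_subset_G G.set_product_closed[OF Kc])
  have B: "subgroup B G" "B \<subseteq> kernel G H h"
    using subgroup_kernel_stabiliser[OF Pc] by (auto simp: B_def kernel_stabiliser_def)
  note stab = kernel_stabiliser_set_product[OF Ks(2) A P, folded B_def]
  have Bc: "B \<subseteq> carrier G"
    using B(1) by (rule subgroup.subset)
  have sub: "\<forall>K\<in>set Ks. subgroup K G"
    using Ks(2) G.fg_subgroupsD by blast
  let ?Hs = "map ((`) h) Ks"
  have "?Hs \<noteq> []" "set ?Hs \<subseteq> fg_subgroups H" "q \<in> set_product H ?Hs"
    using Ks q by (auto simp: fg_subgroups_img subset_iff simp flip: set_product_img[OF Kc])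
  then obtain R i where R: "R \<subseteq> product_reps H ?Hs q" "i < length Ks" "finite ((\<lambda>hs. hs ! i) ` R)"
    "\<And>hs. hs \<in> product_reps H ?Hs q \<Longrightarrow> \<exists>ks\<in>R. equiv_reps H ?Hs hs ks"
    using bott unfolding bottlenecked_product_reps_def by (metis length_map)
  define I where "I = (\<lambda>hs. hs ! i) ` R"
  have R_nth: "length ks = length Ks" "\<And>j. j < length Ks \<Longrightarrow> ks ! j \<in> h ` (Ks ! j)" if "ks \<in> R" for ks
    using R(1) that by (auto simp: product_reps_def listset_iff)
  have "\<forall>r\<in>I. \<exists>y. y \<in> Ks ! i \<and> h y = r"
    using R_nth(2)[OF _ R(2)] unfolding I_def by fastforce
  \<comment> \<open>One lift is fixed, inside factor \<open>i\<close>, for each of the finitely many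
    values at the bottleneck.\<close>
  then obtain f where f: "\<And>r. r \<in> I \<Longrightarrow> f r \<in> Ks ! i" "\<And>r. r \<in> I \<Longrightarrow> h (f r) = r"
    by metis
  let ?T = "take i Ks" and ?D = "drop (Suc i) Ks"
  have Tfg: "set ?T \<subseteq> fg_subgroups G" and Dfg: "set ?D \<subseteq> fg_subgroups G"
    using Ks(2) by (auto dest: in_set_takeD in_set_dropD)
  note Tc = fg_subgroups_subset_carrier[OF Tfg] and Dc = fg_subgroups_subset_carrier[OF Dfg]
  have c: "set_product G ?T \<subseteq> carrier G" "set_product G ?D \<subseteq> carrier G" "Ks ! i \<subseteq> carrier G"
    using Tc Dc Kc R(2) by (auto intro!: G.set_product_closed del: subsetI)
  have fc: "f r \<in> carrier G" if "r \<in> I" for r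
    using f(1)[OF that] c(3) by blast
  have split: "Ks = ?T @ Ks ! i # ?D"
    by (rule id_take_nth_drop[OF R(2)])
  have prod_split: "set_product G Ks = set_product G ?T <#> (Ks ! i <#> set_product G ?D)"
    by (subst split, subst G.set_product_append) (use Tc Dc c in \<open>auto simp: set_product_Cons\<close>)
  have KsP: "set_product G Ks \<subseteq> P"
  proof
    fix p assume "p \<in> set_product G Ks"
    moreover from this have "p = p \<otimes> \<one>"
      using G.set_product_closed[OF Kc] by auto
    ultimately show "p \<in> P"
      unfolding P set_mult_def using subgroup.one_closed[OF A(1)] by blast
  qed
  define conj where "conj = (\<lambda>r. (`) (\<lambda>x. inv r \<otimes> x \<otimes> r))"
  \<comment> \<open>The constant \<open>f r\<close> replaces factor \<open>i\<close>; pulling it to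
    the far left conjugates the factors before it, so one factor fewer remains.\<close>
  define L where "L = (\<lambda>r. map (conj (f r)) ?T @ ?D)"
  have Lfg: "set (L r) \<subseteq> fg_subgroups G" if "r \<in> I" for r
    using Tfg Dfg fc[OF that] unfolding L_def conj_def by (auto intro: G.conj_fg_subgroups)
  have prod_L: "f r <# (set_product G (L r) <#> B)
      = set_product G ?T <#> (f r <# (set_product G ?D <#> B))" if "r \<in> I" for r
  proof -
    let ?T' = "map (conj (f r)) ?T"
    have T'c: "\<forall>K\<in>set ?T'. K \<subseteq> carrier G"
      using Lfg[OF that] by (intro fg_subgroups_subset_carrier) (simp add: L_def)
    have cc: "set_product G ?T' \<subseteq> carrier G"
      by (rule G.set_product_closed[OF T'c])
    have "f r <# (set_product G (L r) <#> B)
        = f r <# (set_product G ?T' <#> (set_product G ?D <#> B))"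
      unfolding L_def using T'c Dc cc c Bc by (subst G.set_product_append) (auto simp: G.set_mult_assoc)
    also have "\<dots> = (f r <# set_product G ?T') <#> (set_product G ?D <#> B)"
      using fc[OF that] cc c Bc by (simp add: G.setmult_lcos_assoc G.setmult_subset_G)
    also have "f r <# set_product G ?T' = set_product G ?T #> f r"
      using G.r_coset_set_product[OF fc[OF that] Tc] by (simp add: conj_def)
    also have "(set_product G ?T #> f r) <#> (set_product G ?D <#> B)
        = set_product G ?T <#> (f r <# (set_product G ?D <#> B))"
      using fc[OF that] c Bc by (intro G.rcos_assoc_lcos) (auto intro!: G.setmult_subset_G del: subsetI)
    finally show ?thesis .
  qed
  show ?thesis
  proof (rule that[of "(\<lambda>r. (f r, L r)) ` I" B])
    show "finite ((\<lambda>r. (f r, L r)) ` I)"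
      using R(3) by (simp add: I_def)
    show "(\<lambda>r. (f r, L r)) ` I
        \<subseteq> carrier G \<times> {Ls. Suc (length Ls) = length Ks \<and> set Ls \<subseteq> fg_subgroups G}"
    proof (intro image_subsetI)
      fix r assume r: "r \<in> I"
      have "Suc (length (L r)) = length Ks"
        using R(2) by (simp add: L_def)
      then show "(f r, L r) \<in> carrier G \<times> {Ls. Suc (length Ls) = length Ks \<and> set Ls \<subseteq> fg_subgroups G}"
        using fc[OF r] Lfg[OF r] by simp
    qed
    \<comment> \<open>Putting \<open>f r\<close> back into factor \<open>i\<close> gives a point of
      the full product, hence of \<open>P\<close>, and \<open>B\<close> preserves
      \<open>P\<close>.\<close>
    show "(\<Union>(x, Ls)\<in>(\<lambda>r. (f r, L r)) ` I. x <# (set_product G Ls <#> B)) \<subseteq> P"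
    proof
      fix y assume "y \<in> (\<Union>(x, Ls)\<in>(\<lambda>r. (f r, L r)) ` I. x <# (set_product G Ls <#> B))"
      then obtain r where r: "r \<in> I" "y \<in> f r <# (set_product G (L r) <#> B)"
        by auto
      then obtain t d b where y: "t \<in> set_product G ?T" "d \<in> set_product G ?D" "b \<in> B"
        "y = t \<otimes> (f r \<otimes> (d \<otimes> b))"
        unfolding prod_L[OF r(1)] by (auto simp: set_mult_def l_coset_def)
      have "t \<otimes> (f r \<otimes> d) \<in> set_product G Ks"
        using y(1,2) f(1)[OF r(1)] unfolding prod_split set_mult_def by blast
      then have "t \<otimes> (f r \<otimes> d) \<in> P"
        using KsP by blast
      moreover have "y = t \<otimes> (f r \<otimes> d) \<otimes> b"
        using y c Bc fc[OF r(1)] by (simp add: G.m_assoc subset_iff)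
      ultimately show "y \<in> P"
        using y(3) by (simp add: B_def kernel_stabiliser_def)
    qed
    fix p assume p: "p \<in> P" "h p = q"
    obtain hs a where hs: "hs \<in> listset Ks" "a \<in> A" "p = foldr (\<otimes>) hs \<one> \<otimes> a"
      using p(1) unfolding P set_mult_def set_product_eq_foldr by blast
    have hsc: "set hs \<subseteq> carrier G"
      using listset_subset_carrier[OF hs(1) Kc] .
    have aK: "a \<in> carrier G" "h a = \<one>\<^bsub>H\<^esub>"
      using kernelD hs(2) A(2) by auto
    have len: "length hs = length Ks"
      using hs(1) by (simp add: listset_iff)
    have "q = foldr (\<lambda>x y. x \<otimes>\<^bsub>H\<^esub> y) (map h hs) \<one>\<^bsub>H\<^esub>"
      using p(2) aK hsc by (simp add: hs(3) G.foldr_mult_closed hom_foldr_mult[symmetric])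
    then have "map h hs \<in> product_reps H ?Hs q"
      using hs(1) by (simp add: product_reps_def listset_iff)
    then obtain ks where ks: "ks \<in> R" "equiv_reps H ?Hs (map h hs) ks"
      using R(4) by blast
    obtain s where s: "s 0 = \<one>\<^bsub>H\<^esub>" "s (length Ks) = \<one>\<^bsub>H\<^esub>"
      "\<forall>i\<in>{1..<length Ks}. s i \<in> ?Hs ! (i - 1) \<inter> ?Hs ! i"
      "\<forall>i<length Ks. s i \<otimes>\<^bsub>H\<^esub> ks ! i = map h hs ! i \<otimes>\<^bsub>H\<^esub> s (Suc i)"
      using ks(2) unfolding equiv_reps_def length_map by (elim exE conjE) (rule that)
    have "\<exists>ls\<in>listset Ks. map h ls = ks \<and>
        (\<exists>w\<in>B. foldr (\<otimes>) hs \<one> = \<one> \<otimes> foldr (\<otimes>) ls \<one> \<otimes> w)"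
    \<comment> \<open>As \<open>s 0\<close> is the unit, the unit serves as its lift in the first
      factor.\<close>
    proof (rule lift_equivalent_rep[where s = s])
      show "length ks = length Ks"
        using R_nth ks(1) by blast
      show "set ks \<subseteq> carrier H"
      proof
        fix k assume "k \<in> set ks"
        then obtain j where j: "j < length Ks" "k = ks ! j"
          using R_nth(1)[OF ks(1)] by (auto simp: in_set_conv_nth)
        then have "Ks ! j \<subseteq> carrier G"
          using Kc by simp
        then show "k \<in> carrier H"
          using R_nth(2)[OF ks(1) j(1)] j(2) by auto
      qed
      show "\<forall>i. Suc i < length Ks \<longrightarrow> s (Suc i) \<in> h ` (Ks ! i) \<inter> h ` (Ks ! Suc i)"
      proof (intro allI impI)
        fix j assume "Suc j < length Ks"
        then show "s (Suc j) \<in> h ` (Ks ! j) \<inter> h ` (Ks ! Suc j)"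
          using s(3)[rule_format, of "Suc j"] by simp
      qed
      show "\<forall>i<length Ks. s i \<otimes>\<^bsub>H\<^esub> ks ! i = h (hs ! i) \<otimes>\<^bsub>H\<^esub> s (Suc i)"
        using s(4) len by simp
      show "\<one> \<in> Ks ! 0"
        using Ks(1) sub by (simp add: subgroup.one_closed)
    qed (use sub Ks(1) B hs(1) s(1,2) stab(3) in auto)
    then obtain ls w where ls: "ls \<in> listset Ks" "map h ls = ks" "w \<in> B"
      "foldr (\<otimes>) hs \<one> = \<one> \<otimes> foldr (\<otimes>) ls \<one> \<otimes> w"
      by blast
    have lsc: "set ls \<subseteq> carrier G"
      using listset_subset_carrier[OF ls(1) Kc] .
    have len_ls: "length ls = length Ks"
      using ls(1) by (simp add: listset_iff)
    define r where "r = ks ! i"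
    define t where "t = foldr (\<otimes>) (take i ls) \<one>"
    define d where "d = foldr (\<otimes>) (drop (Suc i) ls) \<one>"
    \<comment> \<open>Both \<open>f r\<close> and \<open>ls ! i\<close> lift \<open>r\<close> inside
      \<open>Ks ! i\<close>, so they differ by an element of the kernel in that factor, which
      belongs to \<open>B\<close>.\<close>
    define z where "z = inv (f r) \<otimes> ls ! i"
    have r: "r \<in> I"
      using ks(1) by (simp add: r_def I_def)
    have t: "t \<in> set_product G ?T"
      unfolding t_def set_product_eq_foldr
      using ls(1) len_ls by (intro imageI) (simp add: listset_iff)
    have d: "d \<in> set_product G ?D"
      unfolding d_def set_product_eq_foldr
      using ls(1) len_ls by (intro imageI) (simp add: listset_iff)
    have li: "ls ! i \<in> Ks ! i" "h (ls ! i) = r"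
      using ls(1,2) R(2) len_ls by (auto simp: listset_iff r_def)
    have cl: "t \<in> carrier G" "d \<in> carrier G" "ls ! i \<in> carrier G" "f r \<in> carrier G" "w \<in> carrier G"
      using t d li c fc[OF r] ls(3) Bc by auto
    have subi: "subgroup (Ks ! i) G"
      using sub R(2) by simp
    have "r \<in> carrier H"
      using hom_closed[OF cl(4)] f(2)[OF r] by simp
    then have zker: "z \<in> kernel G H h"
      using cl f(2)[OF r] li(2) by (simp add: z_def kernel_def)
    have z: "z \<in> B"
      using zker li(1) f(1)[OF r] stab(2)[OF R(2)]
      by (simp add: z_def subgroup.m_closed[OF subi] subgroup.m_inv_closed[OF subi])
    have zc: "z \<in> carrier G"
      using z Bc by blast
    have "foldr (\<otimes>) ls \<one> = foldr (\<otimes>) (take i ls @ ls ! i # drop (Suc i) ls) \<one>"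
      using R(2) len_ls by (simp add: id_take_nth_drop[symmetric])
    also have "\<dots> = t \<otimes> (ls ! i \<otimes> d)"
      unfolding t_def d_def using lsc cl(3)
      by (subst G.foldr_mult_append) (auto dest: in_set_takeD in_set_dropD)
    also have "ls ! i = f r \<otimes> z"
      using cl by (simp add: z_def G.inv_mult_cancel)
    also have "t \<otimes> (f r \<otimes> z \<otimes> d) = t \<otimes> (f r \<otimes> (z \<otimes> d))"
      using cl zc by (simp add: G.m_assoc)
    also have "z \<otimes> d = d \<otimes> z"
      by (rule kernelD(3)[OF zker cl(2)])
    finally have "p = t \<otimes> (f r \<otimes> (d \<otimes> (z \<otimes> w \<otimes> a)))"
      using cl zc aK by (simp add: hs(3) ls(4) G.m_assoc)
    \<comment> \<open>The corrections come from the choice of \<open>f r\<close>, from passing to an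
      equivalent representative, and from the factor \<open>A\<close>.\<close>
    moreover have "z \<otimes> w \<otimes> a \<in> B"
      using z ls(3) hs(2) stab(1) by (blast intro: subgroup.m_closed[OF B(1)])
    ultimately have "p \<in> f r <# (set_product G (L r) <#> B)"
      unfolding prod_L[OF r] using t d by (auto simp: set_mult_def l_coset_def)
    then show "p \<in> (\<Union>(x, Ls)\<in>(\<lambda>r. (f r, L r)) ` I. x <# (set_product G Ls <#> B))"
      using r by auto
  qed (use B in auto)
qed

section \<open>Induction on the number of factors\<close>

text \<open>The central factor \<open>A\<close> is carried along, and left arbitrary in the
  induction, because the shorter products come with the stabiliser \<open>B\<close> in its place.
  With no factors left, subgroup separability handles \<open>A\<close> itself.\<close>

lemma separable_set_product_mult_central:
  assumes prod: "product_separable H" and bott: "bottlenecked_product_reps H (fg_subgroups H)"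
    and sep: "subgroup_separable G"
    and kernel_fg: "\<And>B. \<lbrakk>subgroup B G; B \<subseteq> kernel G H h\<rbrakk> \<Longrightarrow> B \<in> fg_subgroups G"
    and "set Ks \<subseteq> fg_subgroups G" "subgroup A G" "A \<subseteq> kernel G H h"
  shows "separable_in G (set_product G Ks <#> A)"
  using assms(5-)
proof (induction "length Ks" arbitrary: Ks A)
  case 0
  have "set_product G Ks <#> A = A"
    using 0 subgroup.subset[OF 0(3)] by (force simp: set_mult_def)
  then show ?case
    using sep kernel_fg 0 by (simp add: subgroup_separable_def)
next
  case (Suc n)
  note Ks = Suc.prems(1) and A = Suc.prems(2,3)
  define P where "P = set_product G Ks <#> A"
  note Kc = fg_subgroups_subset_carrier[OF Ks]
  have ne: "Ks \<noteq> []"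
    using Suc.hyps(2) by auto
  have Ac: "A \<subseteq> carrier G"
    using A(1) by (rule subgroup.subset)
  have Pc: "P \<subseteq> carrier G"
    unfolding P_def using G.set_product_closed[OF Kc] Ac by (rule G.setmult_subset_G)
  have hP: "h ` P \<subseteq> h ` set_product G Ks"
  proof (intro image_subsetI)
    fix p assume "p \<in> P"
    then obtain x a where x: "x \<in> set_product G Ks" "a \<in> A" "p = x \<otimes> a"
      by (auto simp: P_def set_mult_def)
    have "x \<in> carrier G" "a \<in> kernel G H h"
      using x(1,2) A(2) G.set_product_closed[OF Kc] by auto
    then have "h p = h x"
      by (simp add: x(3) kernelD(1,2))
    with x(1) show "h p \<in> h ` set_product G Ks"
      by simp
  qed
  show ?case
    unfolding P_def[symmetric] G.separable_in_iff
  proof (intro conjI ballI Pc)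
    fix g assume g: "g \<in> carrier G - P"
    show "\<exists>N. N \<lhd> G \<and> finite (rcosets N) \<and> (N #> g) \<inter> P = {}"
    proof (cases "h g \<in> h ` set_product G Ks")
      case False
      have "separable_in H (h ` set_product G Ks)"
        unfolding set_product_img[OF Kc] using ne Ks
        by (intro prod[unfolded product_separable_def, rule_format]) (auto intro: fg_subgroups_img)
      then obtain N where "N \<lhd> G" "finite (rcosets N)"
        "\<And>x. x \<in> N #> g \<Longrightarrow> h x \<notin> h ` set_product G Ks"
        using separate_via_hom g False by blast
      then show ?thesis
        using hP by blast
    next
      case True
      obtain F B where F: "finite F"
        "F \<subseteq> carrier G \<times> {Ls. Suc (length Ls) = length Ks \<and> set Ls \<subseteq> fg_subgroups G}"
        and B: "subgroup B G" "B \<subseteq> kernel G H h"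
        and FP: "(\<Union>(x, Ls)\<in>F. x <# (set_product G Ls <#> B)) \<subseteq> P"
        and PF: "\<And>p. \<lbrakk>p \<in> P; h p = h g\<rbrakk> \<Longrightarrow> p \<in> (\<Union>(x, Ls)\<in>F. x <# (set_product G Ls <#> B))"
        using fibre_as_shorter_products[OF bott ne Ks A P_def True] by blast
      have "separable_in G (x <# (set_product G Ls <#> B))" if "(x, Ls) \<in> F" for x Ls
        using F(2) that Suc.hyps B by (intro G.separable_in_l_coset) auto
      then have "separable_in G (\<Union>((\<lambda>(x, Ls). x <# (set_product G Ls <#> B)) ` F))"
        using F(1) by (intro G.separable_in_Union) auto
      moreover have "g \<notin> (\<Union>(x, Ls)\<in>F. x <# (set_product G Ls <#> B))"
        using FP g by blast
      ultimately obtain N where N: "N \<lhd> G" "finite (rcosets N)"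
        and NF: "(N #> g) \<inter> (\<Union>(x, Ls)\<in>F. x <# (set_product G Ls <#> B)) = {}"
        using g by (auto elim: G.separable_inE)
      define K where "K = N \<inter> kernel G H h"
      have K: "subgroup K G"
        unfolding K_def by (intro G.subgroups_Inter_pair normal_imp_subgroup N subgroup_kernel)
      have Kk: "K \<subseteq> kernel G H h"
        by (simp add: K_def)
      have Kcar: "K \<subseteq> carrier G"
        using K by (rule subgroup.subset)
      \<comment> \<open>Both \<open>A\<close> and \<open>K\<close> are finitely generated, being
        subgroups of the kernel, so the enlarged set is still a product of finitely generated
        subgroups.\<close>
      have PK: "set_product G (Ks @ [A, K]) = P <#> K"
      proof -
        have "set_product G [A, K] = A <#> K"
          using Kcar by (force simp: set_product_Cons set_mult_def)
        then show ?thesis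
          unfolding P_def using Kc Ac Kcar G.set_product_closed[OF Kc]
          by (subst G.set_product_append) (auto simp: G.set_mult_assoc)
      qed
      have "separable_in G (set_product G (Ks @ [A, K]))"
      proof (rule separable_set_product_kernel_stable[OF prod N])
        show "set (Ks @ [A, K]) \<subseteq> fg_subgroups G"
          using Ks kernel_fg A K Kk by simp
        fix p z assume p: "p \<in> set_product G (Ks @ [A, K])" and z: "z \<in> N" "z \<in> kernel G H h"
        then obtain x k where x: "x \<in> P" "k \<in> K" "p = x \<otimes> k"
          unfolding PK by (auto simp: set_mult_def)
        have zK: "z \<in> K" using z by (simp add: K_def)
        have "p \<otimes> z = x \<otimes> (k \<otimes> z)"
          using x zK Pc Kcar by (simp add: G.m_assoc subset_iff)
        then show "p \<otimes> z \<in> set_product G (Ks @ [A, K])"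
          unfolding PK set_mult_def using x zK subgroup.m_closed[OF K] by blast
      qed simp
      moreover have "g \<notin> set_product G (Ks @ [A, K])"
      proof
        assume "g \<in> set_product G (Ks @ [A, K])"
        then obtain p k where p: "p \<in> P" "k \<in> K" "g = p \<otimes> k"
          unfolding PK by (auto simp: set_mult_def)
        have k: "k \<in> kernel G H h" "k \<in> carrier G" "p \<in> carrier G"
          using p Kk Kcar Pc by auto
        have "h p = h g"
          using k by (simp add: p(3) kernelD(2))
        \<comment> \<open>By centrality \<open>p\<close> lies in \<open>N #> g\<close> as well as in
          the fibre of \<open>h g\<close>, hence in the union which \<open>N\<close> was chosen to
          avoid.\<close>
        moreover have "p = inv k \<otimes> g"
          using k by (simp add: p(3) G.inv_mult_cancel flip: kernelD(3)[OF k(1,3)])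
        moreover have "inv k \<in> N"
          using p(2) subgroup.m_inv_closed[OF K] by (auto simp: K_def)
        ultimately have "p \<in> N #> g" "p \<in> (\<Union>(x, Ls)\<in>F. x <# (set_product G Ls <#> B))"
          using PF p(1) by (auto simp: r_coset_def)
        then show False
          using NF by blast
      qed
      ultimately obtain M where "M \<lhd> G" "finite (rcosets M)" "(M #> g) \<inter> set_product G (Ks @ [A, K]) = {}"
        using g G.separable_inE by blast
      moreover have "P \<subseteq> set_product G (Ks @ [A, K])"
      proof
        fix p assume "p \<in> P"
        moreover from this have "p = p \<otimes> \<one>"
          using Pc by auto
        ultimately show "p \<in> set_product G (Ks @ [A, K])"
          unfolding PK set_mult_def using subgroup.one_closed[OF K] by blast
      qed
      ultimately show ?thesis
        by blast
    qed
  qed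
qed

end

section \<open>From the exact sequence to a homomorphism with central kernel\<close>

theorem theorem4p4:
  fixes Q :: "('q, 'e) monoid_scheme"
    and Z :: "('z, 'c) monoid_scheme"
    and G :: "('g, 'd) monoid_scheme"
    and \<iota> :: "'z \<Rightarrow> 'g"
    and \<pi> :: "'g \<Rightarrow> 'q"
  assumes "group Q" and "product_separable Q"
    and "group Z" and "finitely_generated_group Z"
    and "group G" and "central_extension Z \<iota> G \<pi> Q"
    and "subgroup_separable G"
    and "bottlenecked_product_reps Q (fg_subgroups Q)"
  shows "product_separable G"
proof -
  interpret G: group G by fact
  have ext: "\<iota> \<in> hom Z G" "\<pi> \<in> hom G Q" "\<iota> ` carrier Z = kernel G Q \<pi>"
    "\<iota> ` carrier Z \<subseteq> group_centre G"
    using assms(6) by (auto simp: central_extension_def mon_def epi_def)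
  interpret \<pi>: central_group_hom G Q \<pi>
    using assms(1,5) ext
    by (simp add: central_group_hom_def central_group_hom_axioms_def group_hom_def group_hom_axioms_def)
  interpret \<iota>: group_hom Z G \<iota>
    using assms(3,5) ext by (simp add: group_hom_def group_hom_axioms_def)
  obtain S where S: "finite S" "S \<subseteq> carrier Z" "carrier Z = generate Z S"
    using assms(4) by (auto simp: finitely_generated_group_def)
  have kernel: "kernel G Q \<pi> = generate G (\<iota> ` S)"
    using \<iota>.generate_img[OF S(2)] S(3) ext(3) by simp
  \<comment> \<open>The kernel is generated by finitely many central elements, the images of
    generators of \<open>Z\<close>.\<close>
  have kernel_fg: "B \<in> fg_subgroups G" if "subgroup B G" "B \<subseteq> kernel G Q \<pi>" for B
  proof (rule G.fg_subgroup_of_central)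
    show "\<iota> ` S \<subseteq> group_centre G"
      using S(2) ext(4) by blast
    show "B \<subseteq> generate G (\<iota> ` S)"
      using that(2) by (simp add: kernel)
  qed (use S(1) that(1) in auto)
  show ?thesis
    unfolding product_separable_def
  proof (intro allI impI)
    \<comment> \<open>The auxiliary central factor is taken to be trivial.\<close>
    fix Ks assume Ks: "Ks \<noteq> [] \<and> set Ks \<subseteq> fg_subgroups G"
    have "{\<one>\<^bsub>G\<^esub>} \<subseteq> kernel G Q \<pi>"
      by (simp add: kernel_def)
    then have "separable_in G (set_product G Ks <#>\<^bsub>G\<^esub> {\<one>\<^bsub>G\<^esub>})"
      using Ks by (intro \<pi>.separable_set_product_mult_central assms(2,7,8) kernel_fg G.triv_subgroup) auto
    moreover have "set_product G Ks \<subseteq> carrier G"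
      using Ks by (intro G.set_product_closed \<pi>.fg_subgroups_subset_carrier) auto
    then have "set_product G Ks <#>\<^bsub>G\<^esub> {\<one>\<^bsub>G\<^esub>} = set_product G Ks"
      by (force simp: set_mult_def)
    ultimately show "separable_in G (set_product G Ks)"
      by simp
  qed
qed

end
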